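(* Let $p$ be a prime and let $G$ be a finite non-cyclic $p$-group with $|G|\ge p^3$. If the centre $Z(G)$ is elementary abelian and $C_G(Z(\Phi(G)))\neq \Phi(G)$, then $|G|$ divides $|\mathrm{Aut}(G)|$.
   Context: $\mathrm{Aut}(G)$ denotes the automorphism group of $G$, $\Phi(G)$ the Frattini subgroup of $G$, $Z(H)$ the centre of a group $H$, and $C_G(H)$ the centralizer in $G$ of a subgroup $H\le G$. *)

theory Defs
  imports "HOL-Algebra.Algebra" "HOL-Computational_Algebra.Primes"
begin

definition finite_p_group :: "nat \<Rightarrow> ('a, 'b) monoid_scheme \<Rightarrow> bool"
  where "finite_p_group p G \<longleftrightarrow> group G \<and> finite (carrier G) \<and> (\<exists>n. order G = p ^ n)"

definition centralizer :: "('a, 'b) monoid_scheme \<Rightarrow> 'a set \<Rightarrow> 'a set"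
  where "centralizer G S = {g \<in> carrier G. \<forall>s\<in>S. g \<otimes>\<^bsub>G\<^esub> s = s \<otimes>\<^bsub>G\<^esub> g}"

definition centre :: "('a, 'b) monoid_scheme \<Rightarrow> 'a set"
  where "centre G = {z \<in> carrier G. \<forall>g\<in>carrier G. z \<otimes>\<^bsub>G\<^esub> g = g \<otimes>\<^bsub>G\<^esub> z}"

definition maximal_subgroup :: "'a set \<Rightarrow> ('a, 'b) monoid_scheme \<Rightarrow> bool"
  where "maximal_subgroup M G \<longleftrightarrow> subgroup M G \<and> M \<noteq> carrier G \<and>
    (\<forall>H. subgroup H G \<and> M \<subseteq> H \<longrightarrow> H = M \<or> H = carrier G)"

text \<open>Intersecting with the carrier gives \<open>frattini G = carrier G\<close> when there are no
  maximal subgroups.\<close>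
definition frattini :: "('a, 'b) monoid_scheme \<Rightarrow> 'a set"
  where "frattini G = carrier G \<inter> \<Inter>{M. maximal_subgroup M G}"

definition elementary_abelian :: "nat \<Rightarrow> ('a, 'b) monoid_scheme \<Rightarrow> bool"
  where "elementary_abelian p G \<longleftrightarrow>
    comm_group G \<and> (\<forall>x\<in>carrier G. x \<noteq> \<one>\<^bsub>G\<^esub> \<longrightarrow> group.ord G x = p)"

end

(*
The inner automorphisms number |G : Z| with Z = Z(G), so it suffices to adjoin a p-group of
automorphisms contributing a factor |Z| modulo Inn(G). For a maximal subgroup M, an element s outside
M and a subgroup U of Z contained in M, the automorphisms fixing M and multiplying s by an element of
U form a group of order |U|.

If Z is not contained in the Frattini subgroup F, then G has a direct factor of order p, and two such
groups of central automorphisms (or, for G elementary abelian, two groups of transvections) suffice.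

If Z <= F, take k in C_G(Z(F)) outside F and a maximal M avoiding k. When C_G(M) <= Z, the group for
(M, k, Z) meets Inn(G) trivially. Otherwise some c in C_G(M) does not commute with k; as k
centralizes Z(F), c lies outside F. The same argument for a maximal N avoiding c either finishes
the proof or gives y in C_G(N) with [c, y] central and nontrivial. If |Z| >= p^2, the groups for
(M, y, Z) and (N, c, Z) contribute |Z|^2 / p^2. If |Z| = p, then c and y generate an extraspecial
group of order p^3 that is a central factor of G, and a transvection of it extends to a non-inner
automorphism of G.
*)
theory Submission
  imports Defs
begin

section \<open>Products of subgroups and maximal subgroups of p-groups\<close>

text \<open>The map s -> s u that is the identity on M can extend to G only if (s u)^i = s^i
  whenever s^i lies in M. For maximal M such i are the multiples of p, so a central u with u^p = 1
  qualifies: this is where the exponent of Z(G) enters. What remains is to count the shifts that are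
  inner. An inner automorphism fixing M pointwise is conjugation by an element of C_G(M), so only
  noncentral elements of C_G(M) can make a shift by Z inner. Such an element c commutes with a
  subgroup of index p and has at most p conjugates; hence each family loses at most a factor p, and
  |Z|^2 / p^2 suffices once |Z| >= p^2. F always centralizes Z(F), so the hypothesis on C_G(Z(F))
  amounts to an element k outside F centralizing Z(F). If c lay in F, it would lie in Z(F), commute
  with k and with M, and be central. For elementary abelian G of rank n the two families have orders
  p^(n-1) and at least p^(n-2); together they reach p^n because n >= 3. Upper bounds on
  intersections are enough throughout: the shift groups are p-groups, so such a bound already yields
  divisibility.\<close>

lemma prime_power_dvd_cofactor:
  fixes p x y :: nat
  assumes "Factorial_Ring.prime p" "x * y = p ^ n" "x \<noteq> 1"
  shows "p dvd x"
proof -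
  have "x dvd p ^ n" using assms(2) by (metis dvd_triv_left)
  then obtain i where i: "x = p ^ i" using divides_primepow_nat[OF assms(1)] by blast
  with assms(3) have "i \<noteq> 0" by (metis power_0)
  then show ?thesis unfolding i by (simp add: dvd_power)
qed

text \<open>Orbits of a p-group have p-power size, so those that are not singletons have size
  divisible by p. If \<open>x\<close> were the only fixed point, \<open>card E\<close> would be 1
  modulo p.\<close>

lemma (in group_action) p_group_second_fixed_point:
  assumes p: "Factorial_Ring.prime p" "order G = p ^ n"
    and E: "finite E" "p dvd card E"
    and x: "x \<in> E" "\<And>g. g \<in> carrier G \<Longrightarrow> \<phi> g x = x"
  shows "\<exists>y\<in>E. y \<noteq> x \<and> (\<forall>g\<in>carrier G. \<phi> g y = y)"
proof (rule ccontr)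
  interpret G: group G by (rule group_hom.axioms(1)[OF group_hom])
  assume no: "\<not> ?thesis"
  have ox: "orbit G \<phi> x = {x}"
    using x(2) G.one_closed unfolding orbit_def by (auto intro!: exI[of _ "\<one>"])
  have "(\<Sum>orb\<in>orbits G E \<phi>. card orb) = (\<Sum>orb\<in>orbits G E \<phi>. \<Sum>x\<in>orb. 1)"
    by simp
  also have "\<dots> = card E" using disjoint_sum[OF E(1)] by (metis card_eq_sum)
  finally have s: "(\<Sum>orb\<in>orbits G E \<phi>. card orb) = card E" .
  have fin: "finite (orbits G E \<phi>)"
    using E(1) unfolding orbits_def by (simp add: setcompr_eq_image)
  have mem: "{x} \<in> orbits G E \<phi>" using ox x(1) unfolding orbits_def by blast
  have "p dvd card orb" if orb: "orb \<in> orbits G E \<phi> - {{x}}" for orb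
  proof -
    obtain y where y: "y \<in> E" "orb = orbit G \<phi> y" using orb by (auto simp: orbits_def)
    have neq: "y \<noteq> x" using orb y ox by auto
    have "card orb * card (stabilizer G \<phi> y) = p ^ n"
      using orbit_stabilizer_theorem[OF y(1)] y(2) p(2) by simp
    moreover have "card orb \<noteq> 1"
    proof
      assume "card orb = 1"
      then obtain z where z: "orb = {z}" by (auto simp: card_1_singleton_iff)
      have "y \<in> orb" using orbit_refl[OF y(1)] y(2) by simp
      then have "orb = {y}" using z by auto
      then have "\<forall>g\<in>carrier G. \<phi> g y = y" using y(2) by (auto simp: orbit_def)
      then show False using no y(1) neq by blast
    qed
    ultimately show ?thesis using prime_power_dvd_cofactor[OF p(1)] by blast
  qed
  then have "p dvd (\<Sum>orb\<in>orbits G E \<phi> - {{x}}. card orb)" by (intro dvd_sum) auto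
  moreover have "card E = 1 + (\<Sum>orb\<in>orbits G E \<phi> - {{x}}. card orb)"
    using s sum.remove[OF fin mem, of card] by simp
  ultimately have "p dvd 1" using E(2) by (metis dvd_add_left_iff)
  then show False using p(1) by (simp add: not_prime_unit)
qed

text \<open>Multiplying on the right by the inverse makes this a left action, as
  \<open>group_action\<close> requires. Its fixed points are the cosets of elements that conjugate
  \<open>H\<close> into itself.\<close>

lemma (in group) right_coset_action:
  assumes "subgroup H G"
  shows "group_action (G\<lparr>carrier := H\<rparr>) (rcosets H) (\<lambda>h. \<lambda>C\<in>rcosets H. C #> inv h)"
proof -
  have H: "H \<subseteq> carrier G" by (rule subgroup.subset[OF assms])
  have cl: "C #> g \<in> rcosets H" if "C \<in> rcosets H" "g \<in> carrier G" for C g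
    using that H unfolding RCOSETS_def by (auto simp: coset_mult_assoc intro!: exI)
  have sub: "C \<subseteq> carrier G" if "C \<in> rcosets H" for C
    using rcosets_subset_PowG[OF assms] that by auto
  have bij: "(\<lambda>C\<in>rcosets H. C #> inv h) \<in> Bij (rcosets H)" if h: "h \<in> H" for h
  proof -
    have hc: "h \<in> carrier G" using h H by auto
    have "bij_betw (\<lambda>C. C #> inv h) (rcosets H) (rcosets H)"
      by (rule bij_betw_byWitness[where f' = "\<lambda>C. C #> h"])
         (auto simp: coset_mult_assoc sub hc cl)
    then have "bij_betw (\<lambda>C\<in>rcosets H. C #> inv h) (rcosets H) (rcosets H)"
      by (simp cong: bij_betw_cong)
    then show ?thesis by (simp add: Bij_def)
  qed
  interpret H: group "G\<lparr>carrier := H\<rparr>" using assms by (rule subgroup_imp_group)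
  show ?thesis
    unfolding group_action_def group_hom_def group_hom_axioms_def
  proof (intro conjI)
    show "group (G\<lparr>carrier := H\<rparr>)" by (rule H.is_group)
    show "group (BijGroup (rcosets H))" by (rule group_BijGroup)
    show "(\<lambda>h. \<lambda>C\<in>rcosets H. C #> inv h) \<in> hom (G\<lparr>carrier := H\<rparr>) (BijGroup (rcosets H))"
    proof (rule homI)
      fix h assume "h \<in> carrier (G\<lparr>carrier := H\<rparr>)"
      then show "(\<lambda>C\<in>rcosets H. C #> inv h) \<in> carrier (BijGroup (rcosets H))"
        using bij by (simp add: BijGroup_def)
    next
      fix h k assume "h \<in> carrier (G\<lparr>carrier := H\<rparr>)" "k \<in> carrier (G\<lparr>carrier := H\<rparr>)"
      then have hk: "h \<in> H" "k \<in> H" "h \<in> carrier G" "k \<in> carrier G" using H by auto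
      show "(\<lambda>C\<in>rcosets H. C #> inv (h \<otimes>\<^bsub>G\<lparr>carrier := H\<rparr>\<^esub> k)) =
        (\<lambda>C\<in>rcosets H. C #> inv h) \<otimes>\<^bsub>BijGroup (rcosets H)\<^esub> (\<lambda>C\<in>rcosets H. C #> inv k)"
        using hk bij
        by (auto simp: BijGroup_def compose_def cl coset_mult_assoc sub inv_mult_group intro!: restrict_ext)
    qed
  qed
qed

text \<open>\<open>H\<close> acts on its right cosets and fixes the coset \<open>H\<close>. The
  number of cosets is a nontrivial power of p, so a second coset \<open>H #> g\<close> is fixed,
  which says that \<open>g\<close> conjugates \<open>H\<close> into \<open>H\<close>.\<close>

lemma (in group) p_group_normalizer_grows:
  assumes p: "Factorial_Ring.prime p" "order G = p ^ n" "finite (carrier G)"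
    and H: "subgroup H G" "H \<noteq> carrier G"
  shows "\<exists>g\<in>carrier G - H. \<forall>h\<in>H. g \<otimes> h \<otimes> inv g \<in> H"
proof -
  interpret act: group_action "G\<lparr>carrier := H\<rparr>" "rcosets H" "\<lambda>h. \<lambda>C\<in>rcosets H. C #> inv h"
    using right_coset_action[OF H(1)] .
  have Hs: "H \<subseteq> carrier G" by (rule subgroup.subset[OF H(1)])
  have fin: "finite (rcosets H)"
    using rcosets_subset_PowG[OF H(1)] p(3) by (meson finite_Pow_iff finite_subset)
  have lag: "card (rcosets H) * card H = p ^ n" using lagrange[OF H(1)] p(2) by simp
  then obtain k where k: "card H = p ^ k"
    using p(1) by (metis dvd_triv_right divides_primepow_nat)
  have "card (rcosets H) \<noteq> 1"
  proof
    assume "card (rcosets H) = 1"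
    then have "card H = card (carrier G)" using lag p(2) by (simp add: order_def)
    then show False using H(2) Hs p(3) by (metis card_subset_eq)
  qed
  then have dv: "p dvd card (rcosets H)" by (rule prime_power_dvd_cofactor[OF p(1) lag])
  have HR: "H \<in> rcosets H"
    using H(1) subgroup.subset[OF H(1)] coset_mult_one by (metis one_closed rcosetsI)
  have "\<exists>C\<in>rcosets H. C \<noteq> H \<and>
    (\<forall>g\<in>carrier (G\<lparr>carrier := H\<rparr>). (\<lambda>C\<in>rcosets H. C #> inv g) C = C)"
  proof (rule act.p_group_second_fixed_point[OF p(1)])
    show "order (G\<lparr>carrier := H\<rparr>) = p ^ k" using k by (simp add: order_def)
    fix g assume "g \<in> carrier (G\<lparr>carrier := H\<rparr>)"
    then have "g \<in> H" by simp
    then show "(\<lambda>C\<in>rcosets H. C #> inv g) H = H"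
      using HR H(1) by (simp add: coset_join2 subgroup.m_inv_closed subgroup.mem_carrier)
  qed (use fin dv HR in auto)
  then obtain C where C: "C \<in> rcosets H" "C \<noteq> H" "\<And>h. h \<in> H \<Longrightarrow> C #> inv h = C" by auto
  then obtain g where g: "g \<in> carrier G" "C = H #> g" by (auto simp: RCOSETS_def)
  have "g \<notin> H" using C(2) g H(1) by (metis coset_join2)
  moreover have "g \<otimes> h \<otimes> inv g \<in> H" if h: "h \<in> H" for h
  proof -
    have hc: "h \<in> carrier G" using h Hs by auto
    have "inv h \<in> H" using H(1) h by (simp add: subgroup.m_inv_closed)
    then have "C #> h = C" using C(3)[of "inv h"] hc by simp
    then have "H #> (g \<otimes> h) = H #> g" using g hc Hs by (simp add: coset_mult_assoc)
    then show ?thesis using g hc Hs H(1)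
      by (metis coset_mult_inv2 coset_join1 inv_closed m_closed coset_mult_assoc r_inv coset_mult_one)
  qed
  ultimately show ?thesis using g(1) by blast
qed

lemma (in group) subgroup_product:
  assumes S: "subgroup S G" and T: "subgroup T G"
    and norm: "\<And>x s. \<lbrakk>x \<in> T; s \<in> S\<rbrakk> \<Longrightarrow> x \<otimes> s \<otimes> inv x \<in> S"
  shows "subgroup (S <#> T) G"
proof (rule subgroupI)
  note Sc = subgroup.mem_carrier[OF S] and Tc = subgroup.mem_carrier[OF T]
  show "S <#> T \<subseteq> carrier G" using Sc Tc by (auto simp: set_mult_def)
  show "S <#> T \<noteq> {}"
    using subgroup.one_closed[OF S] subgroup.one_closed[OF T] by (auto simp: set_mult_def)
  fix a assume "a \<in> S <#> T"
  then obtain s x where a: "a = s \<otimes> x" "s \<in> S" "x \<in> T" by (auto simp: set_mult_def)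
  have "inv a = (inv x \<otimes> inv s \<otimes> inv (inv x)) \<otimes> inv x"
    using a Sc Tc by (simp add: inv_mult_group m_assoc)
  moreover have "inv x \<otimes> inv s \<otimes> inv (inv x) \<in> S" "inv x \<in> T"
    using a norm S T by (auto simp: subgroup.m_inv_closed)
  ultimately show "inv a \<in> S <#> T" by (auto simp: set_mult_def)
next
  note Sc = subgroup.mem_carrier[OF S] and Tc = subgroup.mem_carrier[OF T]
  fix a b assume "a \<in> S <#> T" "b \<in> S <#> T"
  then obtain s x t y where ab: "a = s \<otimes> x" "s \<in> S" "x \<in> T" "b = t \<otimes> y" "t \<in> S" "y \<in> T"
    by (auto simp: set_mult_def)
  have "a \<otimes> b = (s \<otimes> (x \<otimes> t \<otimes> inv x)) \<otimes> (x \<otimes> y)"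
    using ab Sc Tc by (simp add: m_assoc inv_solve_left)
  moreover have "s \<otimes> (x \<otimes> t \<otimes> inv x) \<in> S" "x \<otimes> y \<in> T"
    using ab norm S T by (auto simp: subgroup.m_closed)
  ultimately show "a \<otimes> b \<in> S <#> T" by (auto simp: set_mult_def)
qed

lemma (in group) subset_set_mult_subgroup:
  assumes "S \<subseteq> carrier G" "subgroup T G"
  shows "S \<subseteq> S <#> T"
proof
  fix s assume s: "s \<in> S"
  then have "s \<otimes> \<one> \<in> S <#> T"
    using subgroup.one_closed[OF assms(2)] unfolding set_mult_def by blast
  then show "s \<in> S <#> T" using s assms(1) by (metis r_one subsetD)
qed

lemma (in group) card_subgroup_product:
  assumes fin: "finite (carrier G)" and S: "subgroup S G" and T: "subgroup T G"
    and ST: "subgroup (S <#> T) G"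
  shows "card (S <#> T) * card (S \<inter> T) = card S * card T"
proof -
  note Sc = subgroup.mem_carrier[OF S] and Tc = subgroup.mem_carrier[OF T]
  note Ss = subgroup.subset[OF S] and Ts = subgroup.subset[OF T]
  interpret P: group "G\<lparr>carrier := S <#> T\<rparr>" using ST by (rule subgroup_imp_group)
  have "S \<subseteq> S <#> T" by (rule subset_set_mult_subgroup[OF Ss T])
  then have sub: "subgroup S (G\<lparr>carrier := S <#> T\<rparr>)"
    using S ST by (simp add: subgroup_incl)
  let ?R = "(\<lambda>x. S #> x) ` T"
  have "rcosets\<^bsub>G\<lparr>carrier := S <#> T\<rparr>\<^esub> S = ?R"
  proof -
    have "S #> (s \<otimes> x) = S #> x" if "s \<in> S" "x \<in> T" for s x
      using that Sc Tc Ss by (metis S coset_join2 coset_mult_assoc)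
    then show ?thesis
      using subgroup.one_closed[OF S] Tc
      by (auto simp: RCOSETS_def r_coset_def set_mult_def image_iff)
  qed
  then have 1: "card ?R * card S = card (S <#> T)"
    using P.lagrange[OF sub] by (simp add: order_def)
  \<comment> \<open>\<open>T\<close> is sorted by the coset of \<open>S\<close> that an element
    generates; each class is a translate of \<open>S \<inter> T\<close>.\<close>
  have "card T = (\<Sum>C\<in>?R. card {x \<in> T. S #> x = C})"
    using sum.image_gen[of T "\<lambda>_. 1::nat" "\<lambda>x. S #> x"] finite_subset[OF Ts fin]
    by simp
  also have "\<dots> = (\<Sum>C\<in>?R. card (S \<inter> T))"
  proof (rule sum.cong)
    fix C assume "C \<in> ?R"
    then obtain x where x: "x \<in> T" "C = S #> x" by auto
    have "{y \<in> T. S #> y = C} = (\<lambda>t. t \<otimes> x) ` (S \<inter> T)"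
    proof (intro equalityI subsetI)
      fix y assume "y \<in> {y \<in> T. S #> y = C}"
      then have y: "y \<in> T" "S #> y = S #> x" using x by auto
      have "y \<in> S #> y" by (rule rcos_self[OF Tc[OF y(1)] S])
      then obtain s where s: "s \<in> S" "y = s \<otimes> x" using y(2) by (auto simp: r_coset_def)
      then have "s = y \<otimes> inv x" using x y Tc Sc by (simp add: m_assoc)
      then have "s \<in> T" using x y T by (simp add: subgroup.m_closed subgroup.m_inv_closed)
      then show "y \<in> (\<lambda>t. t \<otimes> x) ` (S \<inter> T)" using s by auto
    next
      fix y assume "y \<in> (\<lambda>t. t \<otimes> x) ` (S \<inter> T)"
      then obtain t where t: "t \<in> S" "t \<in> T" "y = t \<otimes> x" by auto
      have "S #> y = S #> x" using t x Sc Tc Ss S by (metis coset_join2 coset_mult_assoc)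
      then show "y \<in> {y \<in> T. S #> y = C}" using t x T by (simp add: subgroup.m_closed)
    qed
    moreover have "inj_on (\<lambda>t. t \<otimes> x) (S \<inter> T)"
      using Sc Tc x by (auto intro!: inj_onI)
    ultimately show "card {x \<in> T. S #> x = C} = card (S \<inter> T)" by (simp add: card_image)
  qed simp
  finally have "card T = card ?R * card (S \<inter> T)" by simp
  then show ?thesis using 1 by (metis mult.assoc mult.commute)
qed

text \<open>The order of \<open>S \<inter> T\<close> divides \<open>p ^ a\<close>, hence is a power
  of p, and an upper bound on it bounds the exponent. Thus a mere inequality for the intersection
  gives divisibility for the product.\<close>

lemma (in group) p_subgroup_extension:
  assumes fin: "finite (carrier G)" and p: "Factorial_Ring.prime p"
    and S: "subgroup S G" and T: "subgroup T G"
    and norm: "\<And>x s. \<lbrakk>x \<in> T; s \<in> S\<rbrakk> \<Longrightarrow> x \<otimes> s \<otimes> inv x \<in> S"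
    and card: "card T = p ^ a" "card (S \<inter> T) \<le> p ^ b" "b \<le> a"
  shows "subgroup (S <#> T) G" and "card S * p ^ (a - b) dvd card (S <#> T)"
proof -
  show ST: "subgroup (S <#> T) G" by (rule subgroup_product[OF S T norm])
  interpret T: group "G\<lparr>carrier := T\<rparr>" using T by (rule subgroup_imp_group)
  have "subgroup (S \<inter> T) (G\<lparr>carrier := T\<rparr>)"
    using S T subgroups_Inter_pair by (simp add: subgroup_incl)
  from T.lagrange[OF this] card(1)
  have "card (rcosets\<^bsub>G\<lparr>carrier := T\<rparr>\<^esub> (S \<inter> T)) * card (S \<inter> T) = p ^ a"
    by (simp add: order_def)
  then have "card (S \<inter> T) dvd p ^ a" by (metis dvd_triv_right)
  then obtain c where c: "card (S \<inter> T) = p ^ c" "c \<le> a"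
    using divides_primepow_nat[OF p] by blast
  have "c \<le> b" using card(2) c(1) p by (metis power_le_imp_le_exp prime_gt_1_nat)
  have "card (S <#> T) * p ^ c = (card S * p ^ (a - c)) * p ^ c"
    using card_subgroup_product[OF fin S T ST] c card(1) by (simp flip: power_add)
  then have "card (S <#> T) = card S * p ^ (a - c)" using p by (simp add: prime_gt_0_nat)
  then show "card S * p ^ (a - b) dvd card (S <#> T)"
    using \<open>c \<le> b\<close> by (simp add: le_imp_power_dvd mult_dvd_mono)
qed

lemma (in group) finite_closed_imp_subgroup:
  assumes fin: "finite (carrier G)" and H: "H \<subseteq> carrier G" "H \<noteq> {}"
    and closed: "\<And>x y. \<lbrakk>x \<in> H; y \<in> H\<rbrakk> \<Longrightarrow> x \<otimes> y \<in> H"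
  shows "subgroup H G"
proof (rule subgroupI)
  fix a assume a: "a \<in> H"
  then have ac: "a \<in> carrier G" using H by auto
  \<comment> \<open>Exponents start at 1 because the identity is not yet known to lie in
    \<open>H\<close>. The inverse is then the power with exponent one less than the group
    order.\<close>
  have suc: "a [^] Suc k \<in> H" for k
  proof (induction k)
    case 0 show ?case using a ac by simp
  next
    case (Suc k) then show ?case using closed[of "a [^] Suc k" a] a by simp
  qed
  obtain q where q: "order G = Suc q" using fin by (metis order_gt_0_iff_finite gr0_conv_Suc)
  have pow: "a [^] q \<otimes> a = \<one>" using pow_order_eq_1[OF ac] q by simp
  then have inv: "inv a = a [^] q" using ac by (metis inv_equality nat_pow_closed)
  show "inv a \<in> H"
  proof (cases q)
    case 0
    then have "a = \<one>" using pow ac by simp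
    then show ?thesis using a by simp
  next
    case (Suc k) then show ?thesis using suc inv by simp
  qed
qed (use assms in auto)

section \<open>Maximal subgroups of a finite p-group\<close>

locale prime_power_group = group +
  fixes p n :: nat
  assumes finite_carrier: "finite (carrier G)"
    and prime: "Factorial_Ring.prime p"
    and order_eq: "order G = p ^ n"
begin

text \<open>The normalizer strictly contains the maximal subgroup, so it is the whole group. In
  \<open>?N\<close> the inclusion of the conjugate suffices, since closure under products makes a
  nonempty subset of a finite group a subgroup.\<close>

lemma maximal_subgroup_normal:
  assumes "maximal_subgroup M G"
  shows "M \<lhd> G"
proof -
  have M: "subgroup M G" "M \<noteq> carrier G"
    and max: "\<And>H. \<lbrakk>subgroup H G; M \<subseteq> H\<rbrakk> \<Longrightarrow> H = M \<or> H = carrier G"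
    using assms by (auto simp: maximal_subgroup_def)
  note Mc = subgroup.mem_carrier[OF M(1)]
  let ?N = "{g \<in> carrier G. \<forall>m\<in>M. g \<otimes> m \<otimes> inv g \<in> M}"
  have sub: "M \<subseteq> ?N"
    using M(1) Mc by (auto simp: subgroup.m_closed subgroup.m_inv_closed)
  have sN: "subgroup ?N G"
  proof (rule finite_closed_imp_subgroup[OF finite_carrier])
    show "?N \<noteq> {}" using sub subgroup.one_closed[OF M(1)] by auto
    fix g h assume gh: "g \<in> ?N" "h \<in> ?N"
    have "(g \<otimes> h) \<otimes> m \<otimes> inv (g \<otimes> h) \<in> M" if m: "m \<in> M" for m
    proof -
      have "(g \<otimes> h) \<otimes> m \<otimes> inv (g \<otimes> h) = g \<otimes> (h \<otimes> m \<otimes> inv h) \<otimes> inv g"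
        using gh Mc[OF m] by (simp add: m_assoc inv_mult_group)
      then show ?thesis using gh m by simp
    qed
    then show "g \<otimes> h \<in> ?N" using gh by simp
  qed auto
  have "?N \<noteq> M"
  proof -
    obtain g where "g \<in> carrier G - M" "\<forall>m\<in>M. g \<otimes> m \<otimes> inv g \<in> M"
      using p_group_normalizer_grows[OF prime order_eq finite_carrier M] by metis
    then have "g \<in> ?N" "g \<notin> M" by auto
    then show ?thesis by metis
  qed
  with max[OF sN sub] have "?N = carrier G" by simp
  then have "\<forall>g\<in>carrier G. \<forall>m\<in>M. g \<otimes> m \<otimes> inv g \<in> M" by blast
  then show ?thesis using M(1) by (simp add: normal_inv_iff)
qed

text \<open>Bezout: since \<open>s [^] (p ^ n)\<close> is trivial, a multiple of \<open>i\<close>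
  congruent to 1 modulo \<open>p ^ n\<close> recovers \<open>s\<close> from
  \<open>s [^] i\<close>.\<close>

lemma mem_subgroup_of_coprime_pow:
  fixes i :: int
  assumes "subgroup H G" "s \<in> carrier G" "s [^] i \<in> H" "coprime i (int p)"
  shows "s \<in> H"
proof -
  have "coprime i (int (p ^ n))" using assms(4) by simp
  then obtain u v where "u * i + v * int (p ^ n) = 1"
    by (metis bezout_int coprime_iff_gcd_eq_1)
  then have "s = s [^] (i * u + int (p ^ n) * v)" using assms(2) by (simp add: mult.commute)
  also have "\<dots> = (s [^] i) [^] u \<otimes> (s [^] int (p ^ n)) [^] v"
    using assms(2) by (simp add: int_pow_mult int_pow_pow)
  also have "s [^] int (p ^ n) = \<one>"
    using pow_order_eq_1[OF assms(2)] order_eq int_pow_int by metis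
  finally have "s = (s [^] i) [^] u" using assms(2) by simp
  then show ?thesis using assms(1,3) by (metis subgroup_int_pow_closed)
qed

lemma maximal_subgroup_set_mult:
  assumes M: "maximal_subgroup M G" and s: "s \<in> carrier G" "s \<notin> M"
  shows "M <#> generate G {s} = carrier G"
proof -
  interpret N: normal M G by (rule maximal_subgroup_normal[OF M])
  have gs: "subgroup (generate G {s}) G" using s by (simp add: generate_is_subgroup)
  have "subgroup (M <#> generate G {s}) G"
    using subgroup_product[OF N.is_subgroup gs] N.inv_op_closed2
    by (meson gs subgroup.mem_carrier)
  moreover have "M \<subseteq> M <#> generate G {s}"
    by (rule subset_set_mult_subgroup[OF N.subset gs])
  moreover have "s \<in> M <#> generate G {s}"
  proof -
    have "\<one> \<otimes> s \<in> M <#> generate G {s}"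
      unfolding set_mult_def using N.one_closed generate.incl[of s "{s}" G] by blast
    then show ?thesis using s by simp
  qed
  ultimately show ?thesis using M s(2) unfolding maximal_subgroup_def by blast
qed

lemma maximal_subgroup_decomp:
  assumes M: "maximal_subgroup M G" and s: "s \<in> carrier G" "s \<notin> M" and g: "g \<in> carrier G"
  shows "\<exists>i::nat. \<exists>m\<in>M. g = s [^] i \<otimes> m"
proof -
  interpret N: normal M G by (rule maximal_subgroup_normal[OF M])
  \<comment> \<open>Starting from \<open>inv g\<close> and inverting puts the power of
    \<open>s\<close> in front of the element of \<open>M\<close>.\<close>
  have "inv g \<in> M <#> generate G {s}" using maximal_subgroup_set_mult[OF M s] g by simp
  then obtain m k where mk: "m \<in> M" "inv g = m \<otimes> s [^] (k::int)"
    using generate_pow[OF s(1)] by (auto simp: set_mult_def)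
  have "g = inv (m \<otimes> s [^] k)" using mk g by (metis inv_inv)
  also have "\<dots> = s [^] (- k) \<otimes> inv m"
    using mk s N.mem_carrier by (simp add: inv_mult_group int_pow_neg)
  \<comment> \<open>Reduction modulo the group order gives a natural exponent, so later arguments
    can use induction on it.\<close>
  also have "s [^] (- k) = s [^] nat ((- k) mod int (p ^ n))"
  proof -
    have "s [^] (- k) = s [^] (int (p ^ n) * ((- k) div int (p ^ n)) + (- k) mod int (p ^ n))" by simp
    also have "\<dots> = (s [^] int (p ^ n)) [^] ((- k) div int (p ^ n)) \<otimes> s [^] ((- k) mod int (p ^ n))"
      using s by (simp only: int_pow_mult int_pow_pow)
    also have "s [^] int (p ^ n) = \<one>"
      using pow_order_eq_1[OF s(1)] order_eq int_pow_int by metis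
    also have "(- k) mod int (p ^ n) = int (nat ((- k) mod int (p ^ n)))"
      using prime by (simp add: prime_gt_0_nat)
    finally show ?thesis using s by (simp only: int_pow_int int_pow_one l_one nat_pow_closed)
  qed
  finally show ?thesis using mk(1) N.m_inv_closed by blast
qed

text \<open>If \<open>s [^] p\<close> were outside \<open>M\<close>, it would generate G together
  with \<open>M\<close>, so s = m s^(p k) for some m in \<open>M\<close>. Then s^(1 - p k) lies in
  \<open>M\<close>, and as 1 - p k is coprime to p, so does \<open>s\<close>, a
  contradiction.\<close>

lemma maximal_subgroup_pow_mem:
  assumes M: "maximal_subgroup M G" and s: "s \<in> carrier G"
  shows "s [^] p \<in> M"
proof (rule ccontr)
  assume not: "s [^] p \<notin> M"
  interpret N: normal M G by (rule maximal_subgroup_normal[OF M])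
  have "s \<in> M <#> generate G {s [^] p}" using maximal_subgroup_set_mult[OF M _ not] s by simp
  then obtain m b where m: "m \<in> M" "b \<in> generate G {s [^] p}" "s = m \<otimes> b"
    unfolding set_mult_def by blast
  obtain k where b: "b = (s [^] p) [^] (k::int)"
    using generate_pow[of "s [^] p"] s m(2) by auto
  have "b = s [^] (int p * k)"
    unfolding b using int_pow_pow[OF s, of "int p" k] by (simp add: int_pow_int)
  then have "m = s \<otimes> inv (s [^] (int p * k))"
    using s m(1,3) N.mem_carrier by (metis int_pow_closed inv_solve_right)
  also have "\<dots> = s [^] (1 - int p * k)" using s by (simp add: int_pow_diff)
  finally have "s [^] (1 - int p * k) \<in> M" using m(1) by simp
  moreover have "coprime (1 - int p * k) (int p)"
  proof (rule coprimeI)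
    fix c assume "c dvd 1 - int p * k" "c dvd int p"
    then have "c dvd (1 - int p * k) + int p * k" by (intro dvd_add dvd_mult2)
    then show "is_unit c" by simp
  qed
  ultimately have "s \<in> M" using mem_subgroup_of_coprime_pow[OF N.is_subgroup s] by blast
  then have "s [^] p \<in> M" using N.is_subgroup by (metis int_pow_int subgroup_int_pow_closed)
  then show False using not by simp
qed

lemma maximal_subgroup_pow_mem_iff:
  assumes M: "maximal_subgroup M G" and s: "s \<in> carrier G" "s \<notin> M"
  shows "s [^] (i::nat) \<in> M \<longleftrightarrow> p dvd i"
proof
  have sM: "subgroup M G" using M by (simp add: maximal_subgroup_def)
  show "p dvd i" if "s [^] i \<in> M"
  proof (rule ccontr)
    assume "\<not> p dvd i"
    then have "coprime (int i) (int p)" using prime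
      by (metis coprime_commute coprime_int_iff prime_imp_coprime)
    then show False using that s mem_subgroup_of_coprime_pow[OF sM s(1)] by (metis int_pow_int)
  qed
  assume "p dvd i"
  then obtain j where "i = p * j" ..
  then have "s [^] i = (s [^] p) [^] int j" using s by (simp add: int_pow_int nat_pow_pow)
  then show "s [^] i \<in> M"
    using maximal_subgroup_pow_mem[OF M s(1)] sM by (simp add: subgroup_int_pow_closed)
qed

lemma exists_maximal_subgroup:
  assumes "subgroup H G" "H \<noteq> carrier G"
  shows "\<exists>M. maximal_subgroup M G \<and> H \<subseteq> M"
proof -
  let ?S = "{K. subgroup K G \<and> K \<noteq> carrier G \<and> H \<subseteq> K}"
  have "?S \<subseteq> Pow (carrier G)" using subgroup.subset by auto
  then have "finite ?S" using finite_carrier by (meson finite_Pow_iff finite_subset)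
  moreover have "H \<in> ?S" using assms by auto
  ultimately obtain M where M: "M \<in> ?S" "\<And>K. \<lbrakk>K \<in> ?S; M \<subseteq> K\<rbrakk> \<Longrightarrow> M = K"
    using finite_has_maximal[of ?S] by (metis (no_types, lifting) empty_iff)
  then show ?thesis by (intro exI[of _ M]) (auto simp: maximal_subgroup_def)
qed

text \<open>For \<open>s\<close> outside \<open>M\<close>, every element has a unique form s^i m
  with i < p and m in \<open>M\<close>; uniqueness holds because s^i lies in \<open>M\<close> only
  for multiples of p.\<close>

lemma card_maximal_subgroup:
  assumes M: "maximal_subgroup M G"
  shows "card M * p = p ^ n"
proof -
  interpret N: normal M G by (rule maximal_subgroup_normal[OF M])
  obtain s where s: "s \<in> carrier G" "s \<notin> M"
    using M N.subset by (auto simp: maximal_subgroup_def)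
  have inj: "inj_on (\<lambda>(i::nat, m). s [^] i \<otimes> m) ({..<p} \<times> M)"
  proof -
    have *: "i = j \<and> m = m'" if ij: "i \<le> j" "j < p" and m: "m \<in> M" "m' \<in> M"
      and eq: "s [^] i \<otimes> m = s [^] j \<otimes> m'" for i j m m'
    proof -
      have mc: "m \<in> carrier G" "m' \<in> carrier G" using m N.mem_carrier by auto
      have "s [^] j = s [^] i \<otimes> s [^] (j - i)" using ij s by (simp add: nat_pow_mult)
      then have "s [^] i \<otimes> m = s [^] i \<otimes> (s [^] (j - i) \<otimes> m')" using eq mc s by (simp add: m_assoc)
      then have m1: "m = s [^] (j - i) \<otimes> m'" using mc s by simp
      then have "s [^] (j - i) = m \<otimes> inv m'" using mc s by (metis inv_solve_right nat_pow_closed)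
      then have "s [^] (j - i) \<in> M" using m by simp
      then have "p dvd j - i" using maximal_subgroup_pow_mem_iff[OF M s] by simp
      moreover have "j - i < p" using ij by simp
      ultimately have "j - i = 0" using nat_dvd_not_less by blast
      then show ?thesis using ij m1 mc(2) by auto
    qed
    show ?thesis
    proof (rule inj_onI)
      fix x y
      assume x: "x \<in> {..<p} \<times> M" and y: "y \<in> {..<p} \<times> M"
        and eq: "(\<lambda>(i::nat, m). s [^] i \<otimes> m) x = (\<lambda>(i::nat, m). s [^] i \<otimes> m) y"
      obtain i m j m' where ij: "x = (i, m)" "y = (j, m')" by fastforce
      have b: "i < p" "j < p" "m \<in> M" "m' \<in> M" using x y ij by auto
      have eq': "s [^] i \<otimes> m = s [^] j \<otimes> m'" using eq ij by simp
      have "i = j \<and> m = m'"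
      proof (cases "i \<le> j")
        case True show ?thesis by (rule *[OF True b(2-4) eq'])
      next
        case False
        then have "j = i \<and> m' = m" using *[OF _ b(1,4,3) eq'[symmetric]] by linarith
        then show ?thesis by blast
      qed
      then show "x = y" using ij by simp
    qed
  qed
  have "(\<lambda>(i::nat, m). s [^] i \<otimes> m) ` ({..<p} \<times> M) = carrier G"
  proof
    show "(\<lambda>(i::nat, m). s [^] i \<otimes> m) ` ({..<p} \<times> M) \<subseteq> carrier G"
      using s N.mem_carrier by auto
    show "carrier G \<subseteq> (\<lambda>(i::nat, m). s [^] i \<otimes> m) ` ({..<p} \<times> M)"
    proof
      fix g assume "g \<in> carrier G"
      then obtain i :: nat and m where im: "m \<in> M" "g = s [^] i \<otimes> m"
        using maximal_subgroup_decomp[OF M s] by blast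
      have "s [^] i = s [^] (i mod p) \<otimes> s [^] (p * (i div p))"
        using s by (simp add: nat_pow_mult)
      moreover have r: "s [^] (p * (i div p)) \<in> M"
        using maximal_subgroup_pow_mem_iff[OF M s] by simp
      ultimately have "g = s [^] (i mod p) \<otimes> (s [^] (p * (i div p)) \<otimes> m)"
        using im s N.mem_carrier by (simp add: m_assoc)
      then show "g \<in> (\<lambda>(i::nat, m). s [^] i \<otimes> m) ` ({..<p} \<times> M)"
        using im r prime by (auto simp: image_iff prime_gt_0_nat intro!: bexI[of _ "i mod p"])
    qed
  qed
  then have "card (carrier G) = card ({..<p} \<times> M)" using inj card_image by metis
  then show ?thesis using order_eq by (simp add: order_def mult.commute card_cartesian_product)
qed

end

section \<open>Inner automorphisms and automorphisms fixing a normal subgroup\<close>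

context group
begin

lemma carrier_AutoGroup [simp]: "carrier (AutoGroup G) = auto G"
  by (simp add: AutoGroup_def)

lemma auto_closed: "\<lbrakk>\<alpha> \<in> auto G; x \<in> carrier G\<rbrakk> \<Longrightarrow> \<alpha> x \<in> carrier G"
  by (auto simp: auto_def hom_def)

lemma auto_mult: "\<lbrakk>\<alpha> \<in> auto G; x \<in> carrier G; y \<in> carrier G\<rbrakk> \<Longrightarrow> \<alpha> (x \<otimes> y) = \<alpha> x \<otimes> \<alpha> y"
  by (auto simp: auto_def hom_def)

lemma auto_hom: "\<alpha> \<in> auto G \<Longrightarrow> group_hom G G \<alpha>"
  by (intro group_hom.intro group_hom_axioms.intro is_group) (simp add: auto_def)

lemma auto_pow: "\<lbrakk>\<alpha> \<in> auto G; x \<in> carrier G\<rbrakk> \<Longrightarrow> \<alpha> (x [^] (i::nat)) = \<alpha> x [^] i"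
  by (rule group_hom.hom_nat_pow[OF auto_hom])

lemma auto_inv: "\<lbrakk>\<alpha> \<in> auto G; x \<in> carrier G\<rbrakk> \<Longrightarrow> \<alpha> (inv x) = inv \<alpha> x"
  by (rule group_hom.hom_inv[OF auto_hom])

text \<open>Members of \<open>auto G\<close> are extensional, so their values on the carrier
  determine them. The same convention explains the restriction to the carrier in the constructions
  below.\<close>

lemma auto_eqI:
  assumes "\<alpha> \<in> auto G" "\<beta> \<in> auto G" "\<And>x. x \<in> carrier G \<Longrightarrow> \<alpha> x = \<beta> x"
  shows "\<alpha> = \<beta>"
  using assms by (intro extensionalityI[of _ "carrier G"]) (auto simp: auto_def Bij_def)

lemma AutoGroup_mult_apply:
  "\<lbrakk>\<alpha> \<in> auto G; \<beta> \<in> auto G; x \<in> carrier G\<rbrakk> \<Longrightarrow> (\<alpha> \<otimes>\<^bsub>AutoGroup G\<^esub> \<beta>) x = \<alpha> (\<beta> x)"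
  by (simp add: AutoGroup_def BijGroup_def auto_def compose_def)

lemma AutoGroup_one_apply: "x \<in> carrier G \<Longrightarrow> \<one>\<^bsub>AutoGroup G\<^esub> x = x"
  by (simp add: AutoGroup_def BijGroup_def)

lemma AutoGroup_closed:
  "\<lbrakk>\<alpha> \<in> auto G; \<beta> \<in> auto G\<rbrakk> \<Longrightarrow> \<alpha> \<otimes>\<^bsub>AutoGroup G\<^esub> \<beta> \<in> auto G"
  "\<alpha> \<in> auto G \<Longrightarrow> inv\<^bsub>AutoGroup G\<^esub> \<alpha> \<in> auto G"
  using group.is_monoid[OF AutoGroup] group.inv_closed[OF AutoGroup]
    monoid.m_closed[of "AutoGroup G" \<alpha> \<beta>] by auto

lemma AutoGroup_inv_apply:
  assumes "\<alpha> \<in> auto G" "x \<in> carrier G"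
  shows "\<alpha> ((inv\<^bsub>AutoGroup G\<^esub> \<alpha>) x) = x" "(inv\<^bsub>AutoGroup G\<^esub> \<alpha>) (\<alpha> x) = x"
proof -
  have "\<alpha> \<otimes>\<^bsub>AutoGroup G\<^esub> inv\<^bsub>AutoGroup G\<^esub> \<alpha> = \<one>\<^bsub>AutoGroup G\<^esub>"
    and "inv\<^bsub>AutoGroup G\<^esub> \<alpha> \<otimes>\<^bsub>AutoGroup G\<^esub> \<alpha> = \<one>\<^bsub>AutoGroup G\<^esub>"
    using assms(1) by (simp_all add: group.r_inv[OF AutoGroup] group.l_inv[OF AutoGroup])
  then show "\<alpha> ((inv\<^bsub>AutoGroup G\<^esub> \<alpha>) x) = x" "(inv\<^bsub>AutoGroup G\<^esub> \<alpha>) (\<alpha> x) = x"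
    using assms AutoGroup_closed(2)[OF assms(1)]
    by (metis AutoGroup_mult_apply AutoGroup_one_apply)+
qed

lemma finite_auto:
  assumes "finite (carrier G)"
  shows "finite (auto G)"
proof (rule finite_subset)
  show "auto G \<subseteq> carrier G \<rightarrow>\<^sub>E carrier G"
    by (auto simp: auto_def Bij_def PiE_def hom_def)
  show "finite (carrier G \<rightarrow>\<^sub>E carrier G)" using assms by (simp add: finite_PiE)
qed

lemma surjective_endomorphism_auto:
  assumes "finite (carrier G)" and hom: "f \<in> hom G G" and surj: "carrier G \<subseteq> f ` carrier G"
  shows "restrict f (carrier G) \<in> auto G"
proof -
  have "f ` carrier G = carrier G" using hom surj by (auto simp: hom_def)
  then have "bij_betw f (carrier G) (carrier G)"
    using assms(1) by (simp add: bij_betw_def eq_card_imp_inj_on)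
  then have "restrict f (carrier G) \<in> Bij (carrier G)"
    by (simp add: Bij_def cong: bij_betw_cong)
  moreover have "restrict f (carrier G) \<in> hom G G" using hom by (auto simp: hom_def)
  ultimately show ?thesis by (simp add: auto_def)
qed

definition conjugation :: "'a \<Rightarrow> 'a \<Rightarrow> 'a"
  where "conjugation g = (\<lambda>x\<in>carrier G. g \<otimes> x \<otimes> inv g)"

definition inner_autos :: "('a \<Rightarrow> 'a) set"
  where "inner_autos = conjugation ` carrier G"

lemma conjugation_auto: "g \<in> carrier G \<Longrightarrow> conjugation g \<in> auto G"
  unfolding conjugation_def auto_def
  using conjugation_is_bij[of g]
  by (auto simp: Bij_def hom_def m_assoc inv_solve_left intro!: r_cancel_one)

lemma conjugation_group_hom: "group_hom G (AutoGroup G) conjugation"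
proof (intro group_hom.intro group_hom_axioms.intro is_group AutoGroup homI)
  fix g h assume gh: "g \<in> carrier G" "h \<in> carrier G"
  show "conjugation (g \<otimes> h) = conjugation g \<otimes>\<^bsub>AutoGroup G\<^esub> conjugation h"
  proof (rule auto_eqI)
    fix x assume x: "x \<in> carrier G"
    have "(conjugation g \<otimes>\<^bsub>AutoGroup G\<^esub> conjugation h) x = conjugation g (conjugation h x)"
      using gh x by (simp add: AutoGroup_mult_apply conjugation_auto)
    also have "\<dots> = conjugation (g \<otimes> h) x"
      using gh x by (simp add: conjugation_def m_assoc inv_mult_group)
    finally show "conjugation (g \<otimes> h) x = (conjugation g \<otimes>\<^bsub>AutoGroup G\<^esub> conjugation h) x" by simp
  qed (use gh in \<open>simp_all add: conjugation_auto AutoGroup_closed\<close>)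
qed (simp add: conjugation_auto)

lemma inner_autos_subgroup: "subgroup inner_autos (AutoGroup G)"
  unfolding inner_autos_def by (rule group_hom.img_is_subgroup[OF conjugation_group_hom])

text \<open>Conjugating \<open>conjugation g\<close> by an automorphism gives conjugation by the
  image of \<open>g\<close>. This normality is what makes the product of \<open>inner_autos\<close>
  with any group of automorphisms a subgroup.\<close>

lemma inner_autos_conj_closed:
  assumes "\<beta> \<in> auto G" "\<alpha> \<in> inner_autos"
  shows "\<beta> \<otimes>\<^bsub>AutoGroup G\<^esub> \<alpha> \<otimes>\<^bsub>AutoGroup G\<^esub> inv\<^bsub>AutoGroup G\<^esub> \<beta> \<in> inner_autos"
proof -
  obtain g where g: "g \<in> carrier G" "\<alpha> = conjugation g" using assms(2) by (auto simp: inner_autos_def)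
  note cl = assms(1) conjugation_auto[OF g(1)] AutoGroup_closed
  have "\<beta> \<otimes>\<^bsub>AutoGroup G\<^esub> \<alpha> \<otimes>\<^bsub>AutoGroup G\<^esub> inv\<^bsub>AutoGroup G\<^esub> \<beta> = conjugation (\<beta> g)"
  proof (rule auto_eqI)
    fix x assume x: "x \<in> carrier G"
    let ?y = "(inv\<^bsub>AutoGroup G\<^esub> \<beta>) x"
    have y: "?y \<in> carrier G" "\<beta> ?y = x"
      using x assms(1) auto_closed[OF AutoGroup_closed(2)] AutoGroup_inv_apply by auto
    have "(\<beta> \<otimes>\<^bsub>AutoGroup G\<^esub> \<alpha> \<otimes>\<^bsub>AutoGroup G\<^esub> inv\<^bsub>AutoGroup G\<^esub> \<beta>) x = \<beta> (g \<otimes> ?y \<otimes> inv g)"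
      using g x y(1) cl by (simp add: AutoGroup_mult_apply conjugation_def)
    also have "\<dots> = \<beta> g \<otimes> x \<otimes> inv (\<beta> g)"
      using g x y assms(1) by (simp add: auto_mult auto_inv)
    finally show "(\<beta> \<otimes>\<^bsub>AutoGroup G\<^esub> \<alpha> \<otimes>\<^bsub>AutoGroup G\<^esub> inv\<^bsub>AutoGroup G\<^esub> \<beta>) x = conjugation (\<beta> g) x"
      using x by (simp add: conjugation_def)
  qed (use g assms(1) in \<open>simp_all add: conjugation_auto auto_closed AutoGroup_closed\<close>)
  moreover have "\<beta> g \<in> carrier G" using g(1) assms(1) by (simp add: auto_closed)
  ultimately show ?thesis by (simp add: inner_autos_def)
qed

lemma centre_subgroup: "subgroup (centre G) G"
proof (rule subgroupI)
  fix a assume a: "a \<in> centre G"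
  show "inv a \<in> centre G"
    unfolding centre_def
  proof (intro CollectI conjI ballI)
    fix g assume g: "g \<in> carrier G"
    have ac: "a \<in> carrier G" and comm: "g \<otimes> a = a \<otimes> g" using a g by (auto simp: centre_def)
    have "inv a \<otimes> g = inv a \<otimes> (g \<otimes> a) \<otimes> inv a" using ac g by (simp add: m_assoc)
    also have "\<dots> = g \<otimes> inv a" unfolding comm using ac g by (simp flip: m_assoc)
    finally show "inv a \<otimes> g = g \<otimes> inv a" .
  qed (use a in \<open>auto simp: centre_def\<close>)
next
  fix a b assume "a \<in> centre G" "b \<in> centre G"
  then have c: "a \<in> carrier G" "b \<in> carrier G"
    and comm: "\<And>g. g \<in> carrier G \<Longrightarrow> a \<otimes> g = g \<otimes> a" "\<And>g. g \<in> carrier G \<Longrightarrow> b \<otimes> g = g \<otimes> b"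
    by (auto simp: centre_def)
  have "a \<otimes> b \<otimes> g = g \<otimes> (a \<otimes> b)" if g: "g \<in> carrier G" for g
  proof -
    have "a \<otimes> b \<otimes> g = a \<otimes> (g \<otimes> b)" using c g comm(2) by (simp add: m_assoc)
    also have "\<dots> = (g \<otimes> a) \<otimes> b" using c g comm(1)[OF g] by (simp flip: m_assoc)
    finally show ?thesis using c g by (simp add: m_assoc)
  qed
  then show "a \<otimes> b \<in> centre G" using c by (simp add: centre_def)
next
  have "\<one> \<in> centre G" by (simp add: centre_def)
  then show "centre G \<noteq> {}" by auto
qed (simp add: centre_def)

text \<open>First isomorphism theorem for \<open>conjugation\<close>, whose kernel is the centre,
  followed by Lagrange.\<close>

lemma card_inner_autos: "card inner_autos * card (centre G) = order G"
proof -
  interpret H: group_hom G "AutoGroup G" conjugation by (rule conjugation_group_hom)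
  interpret I: group "(AutoGroup G)\<lparr>carrier := inner_autos\<rparr>"
    using inner_autos_subgroup H.H.subgroup_imp_group by simp
  interpret K: group_hom G "(AutoGroup G)\<lparr>carrier := inner_autos\<rparr>" conjugation
    by unfold_locales (use H.homh in \<open>auto simp: hom_def inner_autos_def\<close>)
  have ker: "kernel G ((AutoGroup G)\<lparr>carrier := inner_autos\<rparr>) conjugation = centre G"
  proof -
    have "conjugation g = \<one>\<^bsub>AutoGroup G\<^esub> \<longleftrightarrow> (\<forall>x\<in>carrier G. g \<otimes> x = x \<otimes> g)" if g: "g \<in> carrier G" for g
    proof -
      have "conjugation g = \<one>\<^bsub>AutoGroup G\<^esub> \<longleftrightarrow> (\<forall>x\<in>carrier G. conjugation g x = x)"
        using auto_eqI[OF conjugation_auto[OF g], of "\<one>\<^bsub>AutoGroup G\<^esub>"] H.H.one_closed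
        by (auto simp: AutoGroup_one_apply)
      also have "\<dots> \<longleftrightarrow> (\<forall>x\<in>carrier G. g \<otimes> x = x \<otimes> g)"
        using g by (auto simp: conjugation_def inv_solve_right')
      finally show ?thesis .
    qed
    then show ?thesis by (auto simp: kernel_def centre_def)
  qed
  have "conjugation ` carrier G = carrier ((AutoGroup G)\<lparr>carrier := inner_autos\<rparr>)"
    by (simp add: inner_autos_def)
  from K.FactGroup_iso_set[OF this]
  have "card (carrier (G Mod centre G)) = card inner_autos"
    unfolding ker by (auto simp: iso_def dest!: bij_betw_same_card)
  then have "card (rcosets (centre G)) = card inner_autos" by (simp add: FactGroup_def)
  then show ?thesis using lagrange[OF centre_subgroup] by simp
qed

text \<open>Conjugation by \<open>s\<close> and by \<open>s \<otimes> u\<close> agree on \<open>M\<close> because \<open>u\<close> centralizes \<open>M\<close>, so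
  \<open>s [^] i \<otimes> m \<mapsto> (s \<otimes> u) [^] i \<otimes> m\<close> is multiplicative as soon as it is well defined.\<close>
lemma auto_of_normal_extension:
  assumes fin: "finite (carrier G)" and M: "M \<lhd> G" and s: "s \<in> carrier G"
    and gen: "\<And>g. g \<in> carrier G \<Longrightarrow> \<exists>i::nat. \<exists>m\<in>M. g = s [^] i \<otimes> m"
    and u: "u \<in> M" "\<And>m. m \<in> M \<Longrightarrow> u \<otimes> m = m \<otimes> u"
    and pow: "\<And>i::nat. s [^] i \<in> M \<Longrightarrow> (s \<otimes> u) [^] i = s [^] i"
  shows "\<exists>\<alpha>\<in>auto G. (\<forall>m\<in>M. \<alpha> m = m) \<and> \<alpha> s = s \<otimes> u"
proof -
  interpret N: normal M G by (rule M)
  note Mc [simp] = N.mem_carrier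
  let ?t = "s \<otimes> u"
  have uc: "u \<in> carrier G" and t: "?t \<in> carrier G" using s u(1) by auto
  \<comment> \<open>The same \<open>m'\<close> serves for \<open>s\<close> and for
    \<open>?t\<close>; this is the compatibility that later makes \<open>f\<close>
    multiplicative.\<close>
  have swap: "\<exists>m'\<in>M. m \<otimes> s [^] j = s [^] j \<otimes> m' \<and> m \<otimes> ?t [^] j = ?t [^] j \<otimes> m'"
    if "m \<in> M" for m and j :: nat
    using that
  proof (induction j)
    case 0 then show ?case by (intro bexI[of _ m]) auto
  next
    case (Suc j)
    then obtain k where k: "k \<in> M" "m \<otimes> s [^] j = s [^] j \<otimes> k" "m \<otimes> ?t [^] j = ?t [^] j \<otimes> k" by auto
    let ?k = "inv s \<otimes> k \<otimes> s"
    have kM: "?k \<in> M" using k(1) s by (rule N.inv_op_closed1[rotated])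
    have ks: "k \<otimes> s = s \<otimes> ?k" using k(1) s by (simp flip: m_assoc)
    have "k \<otimes> ?t = s \<otimes> (?k \<otimes> u)" using ks k(1) kM s uc by (simp flip: m_assoc)
    also have "?k \<otimes> u = u \<otimes> ?k" using u(2)[OF kM] by simp
    finally have kt: "k \<otimes> ?t = ?t \<otimes> ?k" using kM s uc by (simp add: m_assoc)
    have "m \<otimes> s [^] Suc j = s [^] j \<otimes> (k \<otimes> s)"
      using k Suc.prems s by (simp flip: m_assoc)
    moreover have "m \<otimes> ?t [^] Suc j = ?t [^] j \<otimes> (k \<otimes> ?t)"
      using k Suc.prems t by (simp flip: m_assoc)
    ultimately have "m \<otimes> s [^] Suc j = s [^] Suc j \<otimes> ?k" "m \<otimes> ?t [^] Suc j = ?t [^] Suc j \<otimes> ?k"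
      unfolding ks kt using kM s t by (simp_all add: m_assoc del: N.m_closed)
    then show ?case using kM by blast
  qed
  have well: "?t [^] i \<otimes> m = ?t [^] j \<otimes> m'"
    \<comment> \<open>Two representations of one element differ by s^(j - i), which then lies in
      \<open>M\<close>, and \<open>pow\<close> says that \<open>?t\<close> has the same power
      there.\<close>
    if le: "i \<le> j" and m: "m \<in> M" "m' \<in> M" and eq: "s [^] i \<otimes> m = s [^] j \<otimes> m'"
    for i j :: nat and m m'
  proof -
    have "s [^] j = s [^] i \<otimes> s [^] (j - i)" using le s by (simp add: nat_pow_mult)
    then have "s [^] i \<otimes> m = s [^] i \<otimes> (s [^] (j - i) \<otimes> m')" using eq m s by (simp add: m_assoc)
    then have m1: "m = s [^] (j - i) \<otimes> m'" using m s by simp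
    then have "s [^] (j - i) = m \<otimes> inv m'" using m s by (metis inv_solve_right nat_pow_closed Mc)
    then have "s [^] (j - i) \<in> M" using m by simp
    then have "?t [^] (j - i) = s [^] (j - i)" by (rule pow)
    moreover have "?t [^] j = ?t [^] i \<otimes> ?t [^] (j - i)" using le t by (simp add: nat_pow_mult)
    ultimately have "?t [^] j \<otimes> m' = ?t [^] i \<otimes> (s [^] (j - i) \<otimes> m')" using m s t by (simp add: m_assoc)
    then show ?thesis using m1 by simp
  qed
  have "\<forall>g\<in>carrier G. \<exists>h. \<exists>i::nat. \<exists>m\<in>M. g = s [^] i \<otimes> m \<and> h = ?t [^] i \<otimes> m"
    using gen by fast
  from bchoice[OF this] obtain f
    where "\<forall>g\<in>carrier G. \<exists>i::nat. \<exists>m\<in>M. g = s [^] i \<otimes> m \<and> f g = ?t [^] i \<otimes> m" ..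
  then have f: "\<And>g. g \<in> carrier G \<Longrightarrow> \<exists>i::nat. \<exists>m\<in>M. g = s [^] i \<otimes> m \<and> f g = ?t [^] i \<otimes> m"
    by (rule bspec)
  have f_eq: "f (s [^] i \<otimes> m) = ?t [^] i \<otimes> m" if m: "m \<in> M" for i :: nat and m
  proof -
    have "s [^] i \<otimes> m \<in> carrier G" using s m by simp
    from f[OF this] obtain j :: nat and k where k: "k \<in> M" "s [^] i \<otimes> m = s [^] j \<otimes> k"
      "f (s [^] i \<otimes> m) = ?t [^] j \<otimes> k" by auto
    show ?thesis unfolding k(3)
      using well[OF _ m k(1,2)] well[OF _ k(1) m k(2)[symmetric]] by (cases "i \<le> j") auto
  qed
  have f_fix: "f m = m" if "m \<in> M" for m using f_eq[OF that, of 0] that by simp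
  have f_s: "f (s \<otimes> m) = ?t \<otimes> m" if "m \<in> M" for m using f_eq[OF that, of 1] that s t by simp
  have hom: "f \<in> hom G G"
  proof (rule homI)
    fix g assume "g \<in> carrier G"
    then obtain i :: nat and m where "m \<in> M" "g = s [^] i \<otimes> m" using gen by blast
    then show "f g \<in> carrier G" using f_eq t by simp
  next
    fix g h assume "g \<in> carrier G" "h \<in> carrier G"
    then obtain i j :: nat and m k where g: "m \<in> M" "g = s [^] i \<otimes> m" and h: "k \<in> M" "h = s [^] j \<otimes> k"
      using gen by meson
    obtain m' where m': "m' \<in> M" "m \<otimes> s [^] j = s [^] j \<otimes> m'" "m \<otimes> ?t [^] j = ?t [^] j \<otimes> m'"
      using swap[OF g(1)] by blast
    have "g \<otimes> h = s [^] i \<otimes> (m \<otimes> s [^] j) \<otimes> k" using g h s by (simp add: m_assoc)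
    also have "\<dots> = s [^] (i + j) \<otimes> (m' \<otimes> k)"
      unfolding m'(2) using m'(1) h s by (simp add: m_assoc flip: nat_pow_mult)
    finally have "f (g \<otimes> h) = ?t [^] (i + j) \<otimes> (m' \<otimes> k)" using f_eq m'(1) h by simp
    also have "\<dots> = ?t [^] i \<otimes> (?t [^] j \<otimes> m') \<otimes> k"
      using m'(1) h t by (simp add: m_assoc flip: nat_pow_mult)
    also have "\<dots> = f g \<otimes> f h"
      unfolding m'(3)[symmetric] using g h f_eq t by (simp add: m_assoc)
    finally show "f (g \<otimes> h) = f g \<otimes> f h" .
  qed
  interpret F: group_hom G G f
    by (intro group_hom.intro group_hom_axioms.intro is_group hom)
  have "carrier G \<subseteq> f ` carrier G"
  proof
    fix g assume "g \<in> carrier G"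
    then obtain i :: nat and m where g: "m \<in> M" "g = s [^] i \<otimes> m" using gen by blast
    \<comment> \<open>\<open>f\<close> fixes \<open>inv u\<close>, an element of \<open>M\<close>,
      so \<open>s \<otimes> inv u\<close> is a preimage of \<open>s\<close>; with \<open>M\<close>
      fixed, the image contains generators of G.\<close>
    have "f (s \<otimes> inv u) = s" using f_s[of "inv u"] u(1) s by (simp add: m_assoc)
    then have "f ((s \<otimes> inv u) [^] i \<otimes> m) = g" using g s uc f_fix F.hom_nat_pow[of "s \<otimes> inv u" i] by simp
    moreover have "(s \<otimes> inv u) [^] i \<otimes> m \<in> carrier G" using g s uc by simp
    ultimately show "g \<in> f ` carrier G" by blast
  qed
  from surjective_endomorphism_auto[OF fin hom this]
  have "restrict f (carrier G) \<in> auto G" .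
  moreover have "restrict f (carrier G) s = ?t" using f_s[OF N.one_closed] s uc by simp
  ultimately show ?thesis using f_fix by (intro bexI[of _ "restrict f (carrier G)"]) auto
qed

end

section \<open>Groups of automorphisms that fix M and shift one element\<close>

context group
begin

text \<open>The quotient of G by \<open>M\<close> is cyclic, generated by the coset of
  \<open>s\<close>. The notion covers both a maximal \<open>M\<close> and, later, the centralizer of
  an element of the second centre.\<close>

definition cyclic_over :: "'a set \<Rightarrow> 'a \<Rightarrow> bool"
  where "cyclic_over M s \<longleftrightarrow> M \<lhd> G \<and> s \<in> carrier G \<and>
    (\<forall>g\<in>carrier G. \<exists>i::nat. \<exists>m\<in>M. g = s [^] i \<otimes> m)"

text \<open>\<open>U\<close> is left arbitrary: it will be a group of central elements in most
  cases, but the group of powers of a noncentral element for transvections.\<close>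

definition shift_autos :: "'a set \<Rightarrow> 'a \<Rightarrow> 'a set \<Rightarrow> ('a \<Rightarrow> 'a) set"
  where "shift_autos M s U = {\<alpha> \<in> auto G. (\<forall>m\<in>M. \<alpha> m = m) \<and> (\<exists>u\<in>U. \<alpha> s = s \<otimes> u)}"

lemma cyclic_over_closed:
  assumes "cyclic_over M s"
  shows "s \<in> carrier G" "\<And>m. m \<in> M \<Longrightarrow> m \<in> carrier G"
  using assms subgroup.mem_carrier[OF normal_imp_subgroup[of M G]] by (auto simp: cyclic_over_def)

lemma maximal_subgroup_closed: "\<lbrakk>maximal_subgroup M G; m \<in> M\<rbrakk> \<Longrightarrow> m \<in> carrier G"
  using subgroup.mem_carrier[of M G m] by (simp add: maximal_subgroup_def)

lemma auto_eq_if_cyclic_over: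
  assumes "cyclic_over M s" "\<alpha> \<in> auto G" "\<beta> \<in> auto G"
    and "\<And>m. m \<in> M \<Longrightarrow> \<alpha> m = \<beta> m" "\<alpha> s = \<beta> s"
  shows "\<alpha> = \<beta>"
proof (rule auto_eqI)
  fix x assume "x \<in> carrier G"
  then obtain i :: nat and m where x: "m \<in> M" "x = s [^] i \<otimes> m"
    using assms(1) by (auto simp: cyclic_over_def)
  have "s \<in> carrier G" "m \<in> carrier G"
    using cyclic_over_closed[OF assms(1)] x(1) by auto
  then show "\<alpha> x = \<beta> x" using assms(2-5) x by (simp add: auto_mult auto_pow)
qed (use assms in auto)

text \<open>As \<open>U\<close> lies in \<open>M\<close>, its elements are fixed, so composition
  multiplies the shifts and inversion inverts them.\<close>

lemma shift_autos_subgroup: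
  assumes co: "cyclic_over M s" and U: "subgroup U G" "U \<subseteq> M"
  shows "subgroup (shift_autos M s U) (AutoGroup G)"
proof -
  interpret A: group "AutoGroup G" by (rule AutoGroup)
  have s: "s \<in> carrier G" and M: "\<And>m. m \<in> M \<Longrightarrow> m \<in> carrier G"
    using cyclic_over_closed[OF co] by auto
  show ?thesis
  proof (rule A.subgroupI)
    show "shift_autos M s U \<subseteq> carrier (AutoGroup G)" by (auto simp: shift_autos_def)
    have "\<one>\<^bsub>AutoGroup G\<^esub> \<in> shift_autos M s U"
      using A.one_closed s M subgroup.one_closed[OF U(1)]
      by (auto simp: shift_autos_def AutoGroup_one_apply intro!: bexI[of _ \<one>])
    then show "shift_autos M s U \<noteq> {}" by auto
    fix \<alpha> assume a: "\<alpha> \<in> shift_autos M s U"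
    then have aut: "\<alpha> \<in> auto G" and fixM: "\<And>m. m \<in> M \<Longrightarrow> \<alpha> m = m" by (auto simp: shift_autos_def)
    obtain u where u: "u \<in> U" "\<alpha> s = s \<otimes> u" using a by (auto simp: shift_autos_def)
    have uc: "u \<in> carrier G" and uM: "inv u \<in> U" "inv u \<in> M"
      using u(1) U M subgroup.m_inv_closed[OF U(1)] by auto
    have "\<alpha> (s \<otimes> inv u) = s"
      using aut s uc u(2) fixM[OF uM(2)] by (simp add: auto_mult m_assoc)
    then have "(inv\<^bsub>AutoGroup G\<^esub> \<alpha>) s = s \<otimes> inv u"
      using AutoGroup_inv_apply(2)[OF aut, of "s \<otimes> inv u"] s uc by simp
    moreover have "(inv\<^bsub>AutoGroup G\<^esub> \<alpha>) m = m" if "m \<in> M" for m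
      using AutoGroup_inv_apply(2)[OF aut M[OF that]] fixM[OF that] by simp
    ultimately show "inv\<^bsub>AutoGroup G\<^esub> \<alpha> \<in> shift_autos M s U"
      using uM(1) AutoGroup_closed(2)[OF aut] by (auto simp: shift_autos_def)
  next
    fix \<alpha> \<beta> assume ab: "\<alpha> \<in> shift_autos M s U" "\<beta> \<in> shift_autos M s U"
    then have aut: "\<alpha> \<in> auto G" "\<beta> \<in> auto G"
      and fixM: "\<And>m. m \<in> M \<Longrightarrow> \<alpha> m = m" "\<And>m. m \<in> M \<Longrightarrow> \<beta> m = m" by (auto simp: shift_autos_def)
    obtain u v where u: "u \<in> U" "\<alpha> s = s \<otimes> u" and v: "v \<in> U" "\<beta> s = s \<otimes> v"
      using ab by (auto simp: shift_autos_def)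
    have c: "u \<in> carrier G" "v \<in> carrier G" "v \<in> M" using u v U M by auto
    have "(\<alpha> \<otimes>\<^bsub>AutoGroup G\<^esub> \<beta>) s = s \<otimes> (u \<otimes> v)"
      using aut s u(2) v(2) c fixM(1)[of v] by (simp add: AutoGroup_mult_apply auto_mult m_assoc)
    moreover have "(\<alpha> \<otimes>\<^bsub>AutoGroup G\<^esub> \<beta>) m = m" if "m \<in> M" for m
      using aut fixM that M by (simp add: AutoGroup_mult_apply)
    moreover have "u \<otimes> v \<in> U" using u(1) v(1) U(1) by (simp add: subgroup.m_closed)
    ultimately show "\<alpha> \<otimes>\<^bsub>AutoGroup G\<^esub> \<beta> \<in> shift_autos M s U"
      using AutoGroup_closed(1)[OF aut] by (auto simp: shift_autos_def)
  qed
qed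

lemma inj_on_shift_autos:
  assumes co: "cyclic_over M s" and U: "U \<subseteq> carrier G"
  shows "inj_on (\<lambda>\<alpha>. inv s \<otimes> \<alpha> s) (shift_autos M s U)"
proof (rule inj_onI)
  fix \<alpha> \<beta> assume ab: "\<alpha> \<in> shift_autos M s U" "\<beta> \<in> shift_autos M s U"
    and eq: "inv s \<otimes> \<alpha> s = inv s \<otimes> \<beta> s"
  have s: "s \<in> carrier G" using co by (simp add: cyclic_over_def)
  have aut: "\<alpha> \<in> auto G" "\<beta> \<in> auto G" using ab by (auto simp: shift_autos_def)
  then have "\<alpha> s = \<beta> s" using eq s auto_closed[of _ s] by simp
  then show "\<alpha> = \<beta>" using ab aut by (intro auto_eq_if_cyclic_over[OF co]) (auto simp: shift_autos_def)
qed

text \<open>An automorphism in the group is determined by its shift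
  \<open>inv s \<otimes> \<alpha> s\<close>. The last two hypotheses are exactly what
  \<open>auto_of_normal_extension\<close> needs to realize every element of \<open>U\<close> as a
  shift.\<close>

lemma card_shift_autos:
  assumes fin: "finite (carrier G)" and co: "cyclic_over M s" and U: "U \<subseteq> M"
    and central: "\<And>u m. \<lbrakk>u \<in> U; m \<in> M\<rbrakk> \<Longrightarrow> u \<otimes> m = m \<otimes> u"
    and pow: "\<And>u i. \<lbrakk>u \<in> U; s [^] (i::nat) \<in> M\<rbrakk> \<Longrightarrow> (s \<otimes> u) [^] i = s [^] i"
  shows "card (shift_autos M s U) = card U"
proof -
  have M: "M \<lhd> G" and s: "s \<in> carrier G"
    and gen: "\<And>g. g \<in> carrier G \<Longrightarrow> \<exists>i::nat. \<exists>m\<in>M. g = s [^] i \<otimes> m"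
    using co by (auto simp: cyclic_over_def)
  have Uc: "U \<subseteq> carrier G" using U M normal_imp_subgroup subgroup.subset by blast
  have "(\<lambda>\<alpha>. inv s \<otimes> \<alpha> s) ` shift_autos M s U = U"
  proof (intro equalityI subsetI)
    fix x assume "x \<in> (\<lambda>\<alpha>. inv s \<otimes> \<alpha> s) ` shift_autos M s U"
    then obtain u where u: "u \<in> U" "x = inv s \<otimes> (s \<otimes> u)" by (auto simp: shift_autos_def)
    have "u \<in> carrier G" using u(1) Uc by auto
    then show "x \<in> U" using u s by (simp flip: m_assoc)
  next
    fix u assume u: "u \<in> U"
    have "u \<in> carrier G" using u Uc by auto
    then have ui: "inv s \<otimes> (s \<otimes> u) = u" using s by (simp flip: m_assoc)
    have "u \<in> M" using u U by auto
    from auto_of_normal_extension[OF fin M s gen this central[OF u] pow[OF u]]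
    obtain \<alpha> where a: "\<alpha> \<in> auto G" "\<forall>m\<in>M. \<alpha> m = m" "\<alpha> s = s \<otimes> u" by blast
    then have "\<alpha> \<in> shift_autos M s U" using u by (auto simp: shift_autos_def)
    moreover have "u = inv s \<otimes> \<alpha> s" using a(3) ui by simp
    ultimately show "u \<in> (\<lambda>\<alpha>. inv s \<otimes> \<alpha> s) ` shift_autos M s U" by simp
  qed
  then show ?thesis using card_image[OF inj_on_shift_autos[OF co Uc]] by simp
qed

text \<open>The shift map is injective, so it is enough to confine the shifts realized inside
  \<open>S\<close> to \<open>U\<^sub>0\<close>. Here \<open>S\<close> will be
  \<open>inner_autos\<close> or its product with another shift group.\<close>

lemma card_Int_shift_autos_le:
  assumes fin: "finite U\<^sub>0" and co: "cyclic_over M s" and U: "U \<subseteq> carrier G"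
    and S: "\<And>\<alpha> u. \<lbrakk>\<alpha> \<in> S; \<alpha> \<in> shift_autos M s U; u \<in> U; \<alpha> s = s \<otimes> u\<rbrakk> \<Longrightarrow> u \<in> U\<^sub>0"
  shows "card (S \<inter> shift_autos M s U) \<le> card U\<^sub>0"
proof (rule card_inj_on_le)
  show "inj_on (\<lambda>\<alpha>. inv s \<otimes> \<alpha> s) (S \<inter> shift_autos M s U)"
    using inj_on_shift_autos[OF co U] by (rule inj_on_subset) auto
  have s: "s \<in> carrier G" using co by (simp add: cyclic_over_def)
  show "(\<lambda>\<alpha>. inv s \<otimes> \<alpha> s) ` (S \<inter> shift_autos M s U) \<subseteq> U\<^sub>0"
  proof
    fix x assume "x \<in> (\<lambda>\<alpha>. inv s \<otimes> \<alpha> s) ` (S \<inter> shift_autos M s U)"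
    then obtain \<alpha> where a: "\<alpha> \<in> S" "\<alpha> \<in> shift_autos M s U" "x = inv s \<otimes> \<alpha> s" by blast
    then obtain u where u: "u \<in> U" "\<alpha> s = s \<otimes> u" by (auto simp: shift_autos_def)
    have "u \<in> carrier G" using u(1) U by auto
    then have "x = u" using a(3) u(2) s by (simp flip: m_assoc)
    then show "x \<in> U\<^sub>0" using S[OF a(1,2) u] by simp
  qed
qed (rule fin)

text \<open>For central \<open>u\<close> one has (s u)^i = s^i u^i, and u^i moves past
  \<open>m\<close>; so a shift of \<open>s\<close> alone displaces every element of G by an element
  of \<open>U\<close>.\<close>

lemma shift_autos_apply:
  assumes co: "cyclic_over M s" and U: "subgroup U G" "U \<subseteq> centre G"
    and a: "\<alpha> \<in> shift_autos M s U" and g: "g \<in> carrier G"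
  shows "\<exists>u\<in>U. \<alpha> g = g \<otimes> u"
proof -
  have M: "\<And>m. m \<in> M \<Longrightarrow> m \<in> carrier G" and s: "s \<in> carrier G"
    using cyclic_over_closed[OF co] by auto
  obtain i :: nat and m where g': "m \<in> M" "g = s [^] i \<otimes> m" using co g by (auto simp: cyclic_over_def)
  obtain u where u: "u \<in> U" "\<alpha> s = s \<otimes> u" using a by (auto simp: shift_autos_def)
  have aut: "\<alpha> \<in> auto G" and fixm: "\<alpha> m = m" using a g'(1) by (auto simp: shift_autos_def)
  have uU: "u [^] i \<in> U" using subgroup_int_pow_closed[OF U(1) u(1), of "int i"] by (simp add: int_pow_int)
  have uc: "u \<in> carrier G" and ui: "u [^] i \<in> carrier G"
    using u(1) U by (auto simp: centre_def)
  have comm: "s \<otimes> u = u \<otimes> s" "u [^] i \<otimes> m = m \<otimes> u [^] i"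
    using u(1) uU U(2) s M[OF g'(1)] by (auto simp: centre_def)
  have "\<alpha> g = (s \<otimes> u) [^] i \<otimes> m" using aut s M g' u(2) fixm by (simp add: auto_mult auto_pow)
  also have "\<dots> = s [^] i \<otimes> (u [^] i \<otimes> m)"
    using s uc M[OF g'(1)] by (simp add: pow_mult_distrib[OF comm(1)] m_assoc)
  also have "\<dots> = g \<otimes> u [^] i" unfolding comm(2) using g'(2) s ui M[OF g'(1)] by (simp add: m_assoc)
  finally show ?thesis using uU by blast
qed

end

section \<open>Shift groups when the centre has exponent dividing p\<close>

locale elementary_centre_group = prime_power_group +
  assumes centre_exponent: "\<And>z. z \<in> centre G \<Longrightarrow> z [^] p = \<one>"
begin

lemma maximal_cyclic_over:
  assumes "maximal_subgroup M G" "s \<in> carrier G" "s \<notin> M"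
  shows "cyclic_over M s"
  using maximal_subgroup_normal[OF assms(1)] maximal_subgroup_decomp[OF assms] assms(2)
  by (simp add: cyclic_over_def)

lemma centre_commute: "\<lbrakk>z \<in> centre G; g \<in> carrier G\<rbrakk> \<Longrightarrow> z \<otimes> g = g \<otimes> z"
  by (simp add: centre_def)

lemma centre_closed: "z \<in> centre G \<Longrightarrow> z \<in> carrier G"
  by (simp add: centre_def)

lemma finite_subset_carrier: "S \<subseteq> carrier G \<Longrightarrow> finite S"
  using finite_carrier finite_subset by blast

text \<open>If s^i lies in \<open>M\<close>, then p divides i, so u^i is trivial for central
  \<open>u\<close> and (s u)^i = s^i. This is the point where the exponent of the centre lets all of
  \<open>U\<close> act.\<close>

lemma card_central_shift_autos:
  assumes M: "maximal_subgroup M G" and s: "s \<in> carrier G" "s \<notin> M"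
    and U: "U \<subseteq> M" "U \<subseteq> centre G"
  shows "card (shift_autos M s U) = card U"
proof (rule card_shift_autos[OF finite_carrier maximal_cyclic_over[OF M s] U(1)])
  have Mc: "\<And>m. m \<in> M \<Longrightarrow> m \<in> carrier G"
    by (rule maximal_subgroup_closed[OF M])
  show "u \<otimes> m = m \<otimes> u" if "u \<in> U" "m \<in> M" for u m
    using that U Mc centre_commute by auto
  fix u and i :: nat assume u: "u \<in> U" and i: "s [^] i \<in> M"
  have uz: "u \<in> centre G" "u \<in> carrier G" using u U centre_closed by auto
  obtain j where j: "i = p * j" using i maximal_subgroup_pow_mem_iff[OF M s] by (auto elim: dvdE)
  have "u [^] i = (u [^] p) [^] j" unfolding j using uz by (simp add: nat_pow_pow)
  then have "u [^] i = \<one>" using centre_exponent uz by simp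
  then show "(s \<otimes> u) [^] i = s [^] i"
    using pow_mult_distrib[OF centre_commute[OF uz(1) s(1), symmetric] s(1) uz(2)] s by simp
qed

lemma order_dvd_order_AutoGroup:
  assumes S: "subgroup S (AutoGroup G)" and dvd: "card inner_autos * k dvd card S"
    and k: "card (centre G) dvd k"
  shows "order G dvd order (AutoGroup G)"
proof -
  have "order G dvd card inner_autos * k" using k card_inner_autos by (metis mult_dvd_mono dvd_refl)
  also have "\<dots> dvd card S" by (rule dvd)
  also have "\<dots> dvd order (AutoGroup G)"
    using group.lagrange[OF AutoGroup S] by (metis dvd_triv_right)
  finally show ?thesis .
qed

text \<open>\<open>U\<^sub>0\<close> collects the shifts that a conjugation fixing \<open>M\<close>
  can produce. With at most \<open>p ^ b\<close> of them, the shift group of order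
  \<open>p ^ a\<close> enlarges \<open>inner_autos\<close> by a factor divisible by
  \<open>p ^ (a - b)\<close>.\<close>

lemma inner_shift_product:
  assumes co: "cyclic_over M s" and U: "subgroup U G" "U \<subseteq> M"
    and card: "card (shift_autos M s U) = p ^ a" "finite U\<^sub>0" "card U\<^sub>0 \<le> p ^ b" "b \<le> a"
    and inner: "\<And>g u. \<lbrakk>g \<in> carrier G; u \<in> U; \<And>m. m \<in> M \<Longrightarrow> g \<otimes> m \<otimes> inv g = m;
      g \<otimes> s \<otimes> inv g = s \<otimes> u\<rbrakk> \<Longrightarrow> u \<in> U\<^sub>0"
  shows "subgroup (inner_autos <#>\<^bsub>AutoGroup G\<^esub> shift_autos M s U) (AutoGroup G)"
    and "card inner_autos * p ^ (a - b) dvd card (inner_autos <#>\<^bsub>AutoGroup G\<^esub> shift_autos M s U)"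
proof -
  have s: "s \<in> carrier G" and Mc: "\<And>m. m \<in> M \<Longrightarrow> m \<in> carrier G"
    using cyclic_over_closed[OF co] by auto
  have "card (inner_autos \<inter> shift_autos M s U) \<le> card U\<^sub>0"
  proof (rule card_Int_shift_autos_le[OF card(2) co])
    show "U \<subseteq> carrier G" by (rule subgroup.subset[OF U(1)])
    fix \<alpha> u assume a: "\<alpha> \<in> inner_autos" "\<alpha> \<in> shift_autos M s U" "u \<in> U" "\<alpha> s = s \<otimes> u"
    obtain g where g: "g \<in> carrier G" "\<alpha> = conjugation g" using a(1) by (auto simp: inner_autos_def)
    show "u \<in> U\<^sub>0"
    proof (rule inner[OF g(1) a(3)])
      show "g \<otimes> m \<otimes> inv g = m" if "m \<in> M" for m
        using a(2) g(2) that Mc[OF that] by (auto simp: shift_autos_def conjugation_def)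
      show "g \<otimes> s \<otimes> inv g = s \<otimes> u" using a(4) g(2) s by (simp add: conjugation_def)
    qed
  qed
  then have le: "card (inner_autos \<inter> shift_autos M s U) \<le> p ^ b" using card(3) by linarith
  have fin: "finite (carrier (AutoGroup G))" using finite_auto[OF finite_carrier] by simp
  have norm: "\<beta> \<otimes>\<^bsub>AutoGroup G\<^esub> \<alpha> \<otimes>\<^bsub>AutoGroup G\<^esub> inv\<^bsub>AutoGroup G\<^esub> \<beta> \<in> inner_autos"
    if "\<beta> \<in> shift_autos M s U" "\<alpha> \<in> inner_autos" for \<beta> \<alpha>
    using that inner_autos_conj_closed by (auto simp: shift_autos_def)
  note ext = group.p_subgroup_extension[OF AutoGroup fin prime inner_autos_subgroup
      shift_autos_subgroup[OF co U] norm card(1) le card(4)]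
  show "subgroup (inner_autos <#>\<^bsub>AutoGroup G\<^esub> shift_autos M s U) (AutoGroup G)" by (rule ext(1))
  show "card inner_autos * p ^ (a - b) dvd card (inner_autos <#>\<^bsub>AutoGroup G\<^esub> shift_autos M s U)"
    by (rule ext(2))
qed

text \<open>The two groups of central automorphisms do not commute, but the one moving \<open>z\<close> normalizes the
  one moving \<open>y\<close>, since \<open>V \<subseteq> U\<close>; the finite sets \<open>U\<^sub>0\<close> and \<open>V\<^sub>0\<close> bound the shifts that are inner.\<close>
lemma two_central_shifts:
  assumes M: "maximal_subgroup M G" "z \<in> carrier G" "z \<notin> M"
    and N: "maximal_subgroup N G" "y \<in> carrier G" "y \<notin> N" and yz: "y \<in> M" "z \<in> N"
    and U: "subgroup U G" "U \<subseteq> N" "U \<subseteq> centre G" and V: "subgroup V G" "V \<subseteq> M" "V \<subseteq> U"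
    and cardU: "card U = p ^ a" "finite U\<^sub>0" "card U\<^sub>0 \<le> p ^ a'" "a' \<le> a"
    and cardV: "card V = p ^ b" "finite V\<^sub>0" "card V\<^sub>0 \<le> p ^ b'" "b' \<le> b"
    and innerU: "\<And>g u. \<lbrakk>g \<in> carrier G; u \<in> U; g \<otimes> y \<otimes> inv g = y \<otimes> u\<rbrakk> \<Longrightarrow> u \<in> U\<^sub>0"
    and innerV: "\<And>g v. \<lbrakk>g \<in> carrier G; v \<in> V; g \<otimes> z \<otimes> inv g = z \<otimes> v\<rbrakk> \<Longrightarrow> v \<in> V\<^sub>0"
    and centre: "card (centre G) dvd p ^ ((a - a') + (b - b'))"
  shows "order G dvd order (AutoGroup G)"
proof -
  interpret A: group "AutoGroup G" by (rule AutoGroup)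
  let ?T = "shift_autos N y U" and ?B = "shift_autos M z V"
  let ?S = "inner_autos <#>\<^bsub>AutoGroup G\<^esub> ?T"
  have coN: "cyclic_over N y" by (rule maximal_cyclic_over[OF N])
  have coM: "cyclic_over M z" by (rule maximal_cyclic_over[OF M])
  have Vz: "V \<subseteq> centre G" using V U by blast
  have Mc: "\<And>m. m \<in> M \<Longrightarrow> m \<in> carrier G" and Nc: "\<And>m. m \<in> N \<Longrightarrow> m \<in> carrier G"
    using maximal_subgroup_closed M(1) N(1) by auto
  have cT: "card ?T = p ^ a" using card_central_shift_autos[OF N U(2,3)] cardU by simp
  have cB: "card ?B = p ^ b" using card_central_shift_autos[OF M V(2) Vz] cardV by simp
  note S = inner_shift_product[OF coN U(1,2) cT cardU(2-4), OF innerU]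
  have Ssub: "subgroup ?S (AutoGroup G)" by (rule S(1)) auto
  have Sdvd: "card inner_autos * p ^ (a - a') dvd card ?S" by (rule S(2)) auto
  have Bsub: "subgroup ?B (AutoGroup G)" by (rule shift_autos_subgroup[OF coM V(1,2)])
  have Baut: "\<And>\<beta>. \<beta> \<in> ?B \<Longrightarrow> \<beta> \<in> auto G" and Taut: "\<And>\<tau>. \<tau> \<in> ?T \<Longrightarrow> \<tau> \<in> auto G"
    by (auto simp: shift_autos_def)
  have normT: "\<beta> \<otimes>\<^bsub>AutoGroup G\<^esub> \<tau> \<otimes>\<^bsub>AutoGroup G\<^esub> inv\<^bsub>AutoGroup G\<^esub> \<beta> \<in> ?T"
    if b: "\<beta> \<in> ?B" and t: "\<tau> \<in> ?T" for \<beta> \<tau>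
  proof -
    let ?i = "inv\<^bsub>AutoGroup G\<^esub> \<beta>"
    have ib: "?i \<in> ?B" using Bsub b by (rule subgroup.m_inv_closed)
    note aut = Baut[OF b] Taut[OF t] Baut[OF ib]
    have app: "(\<beta> \<otimes>\<^bsub>AutoGroup G\<^esub> \<tau> \<otimes>\<^bsub>AutoGroup G\<^esub> ?i) x = \<beta> (\<tau> (?i x))" if "x \<in> carrier G" for x
      using aut that by (simp add: AutoGroup_mult_apply AutoGroup_closed auto_closed)
    have "(\<beta> \<otimes>\<^bsub>AutoGroup G\<^esub> \<tau> \<otimes>\<^bsub>AutoGroup G\<^esub> ?i) m = m" if m: "m \<in> N" for m
    proof -
      obtain v where v: "v \<in> V" "?i m = m \<otimes> v"
        using shift_autos_apply[OF coM V(1) Vz ib Nc[OF m]] by blast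
      \<comment> \<open>\<open>?i\<close> displaces \<open>m\<close> by an element of
        \<open>V\<close>, and \<open>V \<subseteq> U \<subseteq> N\<close>; so the image stays where
        \<open>\<tau>\<close> is the identity.\<close>
      then have "?i m \<in> N" using m V(3) U(2) N(1) by (auto simp: maximal_subgroup_def subgroup.m_closed)
      then have "\<tau> (?i m) = ?i m" using t by (simp add: shift_autos_def)
      then show ?thesis using app[OF Nc[OF m]] AutoGroup_inv_apply(1)[OF aut(1) Nc[OF m]] by simp
    qed
    moreover have "\<exists>u\<in>U. (\<beta> \<otimes>\<^bsub>AutoGroup G\<^esub> \<tau> \<otimes>\<^bsub>AutoGroup G\<^esub> ?i) y = y \<otimes> u"
    proof -
      obtain u where u: "u \<in> U" "\<tau> y = y \<otimes> u" using t by (auto simp: shift_autos_def)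
      have uc: "u \<in> carrier G" using u(1) U(3) centre_closed by auto
      obtain v where v: "v \<in> V" "\<beta> u = u \<otimes> v"
        using shift_autos_apply[OF coM V(1) Vz b uc] by blast
      have "?i y = y" "\<beta> y = y" using ib b yz(1) by (simp_all add: shift_autos_def)
      then have "(\<beta> \<otimes>\<^bsub>AutoGroup G\<^esub> \<tau> \<otimes>\<^bsub>AutoGroup G\<^esub> ?i) y = y \<otimes> (u \<otimes> v)"
        using app[OF N(2)] u(2) v(2) aut(1) N(2) uc by (simp add: auto_mult)
      moreover have "u \<otimes> v \<in> U" using u(1) v(1) V(3) U(1) by (auto simp: subgroup.m_closed)
      ultimately show ?thesis by blast
    qed
    ultimately show ?thesis using aut by (simp add: shift_autos_def AutoGroup_closed)
  qed
  have normS: "\<beta> \<otimes>\<^bsub>AutoGroup G\<^esub> \<sigma> \<otimes>\<^bsub>AutoGroup G\<^esub> inv\<^bsub>AutoGroup G\<^esub> \<beta> \<in> ?S"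
    if b: "\<beta> \<in> ?B" and s: "\<sigma> \<in> ?S" for \<beta> \<sigma>
  proof -
    obtain \<gamma> \<tau> where gt: "\<gamma> \<in> inner_autos" "\<tau> \<in> ?T" "\<sigma> = \<gamma> \<otimes>\<^bsub>AutoGroup G\<^esub> \<tau>"
      using s by (auto simp: set_mult_def)
    have c: "\<beta> \<in> carrier (AutoGroup G)" "\<gamma> \<in> carrier (AutoGroup G)" "\<tau> \<in> carrier (AutoGroup G)"
      using Baut[OF b] Taut[OF gt(2)] subgroup.mem_carrier[OF inner_autos_subgroup gt(1)] by simp_all
    let ?i = "inv\<^bsub>AutoGroup G\<^esub> \<beta>"
    have "?i \<otimes>\<^bsub>AutoGroup G\<^esub> (\<beta> \<otimes>\<^bsub>AutoGroup G\<^esub> (\<tau> \<otimes>\<^bsub>AutoGroup G\<^esub> ?i)) = \<tau> \<otimes>\<^bsub>AutoGroup G\<^esub> ?i"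
      using c by (simp flip: A.m_assoc del: carrier_AutoGroup)
    then have "\<beta> \<otimes>\<^bsub>AutoGroup G\<^esub> \<sigma> \<otimes>\<^bsub>AutoGroup G\<^esub> ?i =
      (\<beta> \<otimes>\<^bsub>AutoGroup G\<^esub> \<gamma> \<otimes>\<^bsub>AutoGroup G\<^esub> ?i) \<otimes>\<^bsub>AutoGroup G\<^esub> (\<beta> \<otimes>\<^bsub>AutoGroup G\<^esub> \<tau> \<otimes>\<^bsub>AutoGroup G\<^esub> ?i)"
      unfolding gt(3) using c by (simp add: A.m_assoc del: carrier_AutoGroup)
    then show ?thesis
      using inner_autos_conj_closed[OF Baut[OF b] gt(1)] normT[OF b gt(2)] by (auto simp: set_mult_def)
  qed
  have "card (?S \<inter> ?B) \<le> card V\<^sub>0"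
  proof (rule card_Int_shift_autos_le[OF cardV(2) coM])
    show "V \<subseteq> carrier G" by (rule subgroup.subset[OF V(1)])
    fix \<alpha> v assume a: "\<alpha> \<in> ?S" "\<alpha> \<in> ?B" "v \<in> V" "\<alpha> z = z \<otimes> v"
    obtain \<gamma> \<tau> where gt: "\<gamma> \<in> inner_autos" "\<tau> \<in> ?T" "\<alpha> = \<gamma> \<otimes>\<^bsub>AutoGroup G\<^esub> \<tau>"
      using a(1) by (auto simp: set_mult_def)
    obtain g where g: "g \<in> carrier G" "\<gamma> = conjugation g" using gt(1) by (auto simp: inner_autos_def)
    \<comment> \<open>Because \<open>z\<close> lies in \<open>N\<close>, the first shift group fixes
      it: an element of \<open>?S\<close> moves \<open>z\<close> only through its inner
      factor.\<close>
    have "\<tau> z = z" using gt(2) yz(2) by (simp add: shift_autos_def)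
    then have "\<alpha> z = g \<otimes> z \<otimes> inv g"
      using gt(3) g M(2) Taut[OF gt(2)] by (simp add: AutoGroup_mult_apply conjugation_auto) (simp add: conjugation_def)
    then show "v \<in> V\<^sub>0" using innerV[OF g(1) a(3)] a(4) by simp
  qed
  then have le: "card (?S \<inter> ?B) \<le> p ^ b'" using cardV(3) by linarith
  have fin: "finite (carrier (AutoGroup G))" using finite_auto[OF finite_carrier] by simp
  note ext = A.p_subgroup_extension[OF fin prime Ssub Bsub normS cB le cardV(4)]
  have "card inner_autos * p ^ ((a - a') + (b - b')) dvd card ?S * p ^ (b - b')"
    using Sdvd by (simp add: power_add mult_dvd_mono flip: mult.assoc)
  also have "\<dots> dvd card (?S <#>\<^bsub>AutoGroup G\<^esub> ?B)" by (rule ext(2))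
  finally show ?thesis using order_dvd_order_AutoGroup[OF ext(1) _ centre] by blast
qed

end

section \<open>Automorphisms of p-groups with elementary abelian centre\<close>

lemma (in group) centralizer_conj:
  assumes M: "M \<lhd> G" and c: "c \<in> centralizer G M" and g: "g \<in> carrier G"
  shows "inv g \<otimes> c \<otimes> g \<in> centralizer G M"
proof -
  interpret N: normal M G by (rule M)
  have cc: "c \<in> carrier G" and comm: "\<And>m. m \<in> M \<Longrightarrow> c \<otimes> m = m \<otimes> c"
    using c by (auto simp: centralizer_def)
  have "inv g \<otimes> c \<otimes> g \<otimes> m = m \<otimes> (inv g \<otimes> c \<otimes> g)" if m: "m \<in> M" for m
  proof -
    have mc: "m \<in> carrier G" using m by (rule N.mem_carrier)
    have k: "g \<otimes> m \<otimes> inv g \<in> M" using N.inv_op_closed2[OF g m] .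
    have "inv g \<otimes> c \<otimes> g \<otimes> m = inv g \<otimes> (c \<otimes> (g \<otimes> m \<otimes> inv g)) \<otimes> g"
      using cc g mc by (simp add: m_assoc)
    also have "\<dots> = m \<otimes> (inv g \<otimes> c \<otimes> g)"
      unfolding comm[OF k] using cc g mc by (simp flip: m_assoc)
    finally show ?thesis .
  qed
  then show ?thesis using cc g by (simp add: centralizer_def)
qed

lemma (in group) centralizer_subgroup:
  assumes fin: "finite (carrier G)" and S: "S \<subseteq> carrier G"
  shows "subgroup (centralizer G S) G"
proof (rule finite_closed_imp_subgroup[OF fin])
  have "\<one> \<in> centralizer G S" using S by (auto simp: centralizer_def)
  then show "centralizer G S \<noteq> {}" by auto
  fix x y assume "x \<in> centralizer G S" "y \<in> centralizer G S"
  then have c: "x \<in> carrier G" "y \<in> carrier G"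
    and comm: "\<And>s. s \<in> S \<Longrightarrow> x \<otimes> s = s \<otimes> x" "\<And>s. s \<in> S \<Longrightarrow> y \<otimes> s = s \<otimes> y"
    by (auto simp: centralizer_def)
  have "x \<otimes> y \<otimes> s = s \<otimes> (x \<otimes> y)" if s: "s \<in> S" for s
  proof -
    have sc: "s \<in> carrier G" using s S by auto
    have "x \<otimes> y \<otimes> s = x \<otimes> (s \<otimes> y)" using c sc comm(2)[OF s] by (simp add: m_assoc)
    also have "\<dots> = (s \<otimes> x) \<otimes> y" using c sc comm(1)[OF s] by (simp flip: m_assoc)
    finally show ?thesis using c sc by (simp add: m_assoc)
  qed
  then show "x \<otimes> y \<in> centralizer G S" using c by (simp add: centralizer_def)
qed (auto simp: centralizer_def)

section \<open>Power identities for central commutators\<close>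

context group
begin

text \<open>The second term of the upper central series, the preimage of the centre of G/Z(G),
  written with elements instead of a quotient group.\<close>

definition second_centre :: "'a set"
  where "second_centre = {x \<in> carrier G. \<forall>g\<in>carrier G. \<exists>z\<in>centre G. x \<otimes> g = g \<otimes> x \<otimes> z}"

text \<open>\<open>w\<close> is the commutator of \<open>c\<close> and \<open>g\<close>. Being
  central, it is multiplicative in the first argument, and in the second by
  \<open>pow_swap_right\<close>.\<close>

lemma pow_swap:
  assumes c: "c \<in> carrier G" "g \<in> carrier G" "w \<in> centre G" and eq: "c \<otimes> g = g \<otimes> c \<otimes> w"
  shows "c [^] (k::nat) \<otimes> g = g \<otimes> c [^] k \<otimes> w [^] k"
proof (induction k)
  case 0 show ?case using c by simp
next
  case (Suc k)
  have wc: "w \<in> carrier G" and w: "\<And>x. x \<in> carrier G \<Longrightarrow> w \<otimes> x = x \<otimes> w"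
    using c(3) by (auto simp: centre_def)
  have "c [^] Suc k \<otimes> g = c [^] k \<otimes> (c \<otimes> g)" using c by (simp add: m_assoc)
  also have "\<dots> = (c [^] k \<otimes> g) \<otimes> (c \<otimes> w)" unfolding eq using c wc by (simp add: m_assoc)
  also have "\<dots> = g \<otimes> c [^] k \<otimes> (w [^] k \<otimes> c) \<otimes> w" unfolding Suc.IH using c wc by (simp add: m_assoc)
  also have "w [^] k \<otimes> c = c \<otimes> w [^] k"
    using group_commutes_pow[OF w[OF c(1)] wc c(1)] .
  finally show ?case using c wc by (simp add: m_assoc)
qed

lemma pow_swap_right:
  assumes c: "c \<in> carrier G" "g \<in> carrier G" "w \<in> centre G" and eq: "c \<otimes> g = g \<otimes> c \<otimes> w"
  shows "c \<otimes> g [^] (k::nat) = g [^] k \<otimes> c \<otimes> w [^] k"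
proof (induction k)
  case 0 show ?case using c by simp
next
  case (Suc k)
  have wc: "w \<in> carrier G" and w: "\<And>x. x \<in> carrier G \<Longrightarrow> w \<otimes> x = x \<otimes> w"
    using c(3) by (auto simp: centre_def)
  have "c \<otimes> g [^] Suc k = (c \<otimes> g [^] k) \<otimes> g" using c by (simp add: m_assoc)
  also have "\<dots> = g [^] k \<otimes> c \<otimes> (w [^] k \<otimes> g)" unfolding Suc.IH using c wc by (simp add: m_assoc)
  also have "w [^] k \<otimes> g = g \<otimes> w [^] k"
    using group_commutes_pow[OF w[OF c(2)] wc c(2)] .
  also have "g [^] k \<otimes> c \<otimes> (g \<otimes> w [^] k) = g [^] k \<otimes> (c \<otimes> g) \<otimes> w [^] k" using c wc by (simp add: m_assoc)
  also have "\<dots> = g [^] Suc k \<otimes> c \<otimes> (w \<otimes> w [^] k)" unfolding eq using c wc by (simp add: m_assoc)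
  also have "w \<otimes> w [^] k = w [^] Suc k" using nat_pow_Suc2[OF wc] by simp
  finally show ?case .
qed

text \<open>The power formula of class two: collecting the k factors \<open>g\<close> on the left
  moves a \<open>c\<close> past a \<open>g\<close> exactly k(k-1)/2 times, and each move releases
  one \<open>w\<close>.\<close>

lemma mult_pow_swap:
  assumes c: "c \<in> carrier G" "g \<in> carrier G" "w \<in> centre G" and eq: "c \<otimes> g = g \<otimes> c \<otimes> w"
  shows "(g \<otimes> c) [^] (k::nat) = g [^] k \<otimes> c [^] k \<otimes> w [^] (k choose 2)"
proof (induction k)
  case 0 show ?case using c by (simp add: binomial_eq_0)
next
  case (Suc k)
  have wc: "w \<in> carrier G" and w: "\<And>x. x \<in> carrier G \<Longrightarrow> w \<otimes> x = x \<otimes> w"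
    using c(3) by (auto simp: centre_def)
  have wp: "w [^] (i::nat) \<otimes> x = x \<otimes> w [^] i" if "x \<in> carrier G" for i x
    using group_commutes_pow[OF w[OF that] wc that] .
  have "(g \<otimes> c) [^] Suc k = g [^] k \<otimes> c [^] k \<otimes> (w [^] (k choose 2) \<otimes> (g \<otimes> c))"
    unfolding nat_pow_Suc Suc.IH using c wc by (simp add: m_assoc)
  also have "w [^] (k choose 2) \<otimes> (g \<otimes> c) = g \<otimes> c \<otimes> w [^] (k choose 2)" using wp c by simp
  also have "g [^] k \<otimes> c [^] k \<otimes> (g \<otimes> c \<otimes> w [^] (k choose 2))
    = g [^] k \<otimes> (c [^] k \<otimes> g) \<otimes> c \<otimes> w [^] (k choose 2)" using c wc by (simp add: m_assoc)
  also have "\<dots> = g [^] Suc k \<otimes> c [^] k \<otimes> (w [^] k \<otimes> c) \<otimes> w [^] (k choose 2)"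
    unfolding pow_swap[OF c eq] using c wc by (simp add: m_assoc)
  also have "w [^] k \<otimes> c = c \<otimes> w [^] k" using wp c by simp
  also have "g [^] Suc k \<otimes> c [^] k \<otimes> (c \<otimes> w [^] k) \<otimes> w [^] (k choose 2)
    = g [^] Suc k \<otimes> c [^] Suc k \<otimes> (w [^] k \<otimes> w [^] (k choose 2))" using c wc by (simp add: m_assoc)
  also have "w [^] k \<otimes> w [^] (k choose 2) = w [^] (Suc k choose 2)"
    using wc by (simp add: nat_pow_mult numeral_2_eq_2)
  finally show ?case .
qed

end

section \<open>Shifts by the whole centre\<close>

context elementary_centre_group
begin

lemma centre_conj:
  assumes "z \<in> centre G" "g \<in> carrier G"
  shows "z \<otimes> g \<otimes> inv z = g" "g \<otimes> z \<otimes> inv g = z"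
proof -
  have zc: "z \<in> carrier G" using assms(1) by (rule centre_closed)
  show "z \<otimes> g \<otimes> inv z = g" unfolding centre_commute[OF assms] using zc assms(2) by (simp add: m_assoc)
  show "g \<otimes> z \<otimes> inv g = z"
    unfolding centre_commute[OF assms, symmetric] using zc assms(2) by (simp add: m_assoc)
qed

lemma card_subgroup_prime_power:
  assumes "subgroup H G"
  shows "\<exists>a. card H = p ^ a"
proof -
  have "card H dvd p ^ n" using lagrange[OF assms] order_eq by (metis dvd_triv_right)
  then show ?thesis using divides_primepow_nat[OF prime] by blast
qed

text \<open>A conjugation fixing \<open>M\<close> pointwise comes from an element of the centralizer
  of \<open>M\<close>, here central, and so is trivial. All |Z| shifts therefore survive modulo
  \<open>inner_autos\<close>.\<close>

lemma order_dvd_if_centralizer_maximal: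
  assumes M: "maximal_subgroup M G" and s: "s \<in> carrier G" "s \<notin> M"
    and Z: "centre G \<subseteq> M" and C: "centralizer G M \<subseteq> centre G"
  shows "order G dvd order (AutoGroup G)"
proof -
  obtain a where a: "card (centre G) = p ^ a" using card_subgroup_prime_power[OF centre_subgroup] by blast
  have card: "card (shift_autos M s (centre G)) = p ^ a"
    using card_central_shift_autos[OF M s Z] a by simp
  have inner: "u \<in> {\<one>}" if g: "g \<in> carrier G" and u: "u \<in> centre G"
    and fx: "\<And>m. m \<in> M \<Longrightarrow> g \<otimes> m \<otimes> inv g = m" and eq: "g \<otimes> s \<otimes> inv g = s \<otimes> u" for g u
  proof -
    have "g \<otimes> m = m \<otimes> g" if m: "m \<in> M" for m
    proof -
      have mc: "m \<in> carrier G" using maximal_subgroup_closed[OF M m] .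
      have "m \<otimes> g = (g \<otimes> m \<otimes> inv g) \<otimes> g" using fx[OF m] by simp
      also have "\<dots> = g \<otimes> m" using g mc by (simp add: m_assoc)
      finally show ?thesis by simp
    qed
    then have "g \<in> centre G" using C g by (auto simp: centralizer_def)
    then have "g \<otimes> s \<otimes> inv g = s" using centre_conj(1) s by simp
    then show ?thesis using eq s centre_closed[OF u] by simp
  qed
  note S = inner_shift_product[OF maximal_cyclic_over[OF M s] centre_subgroup Z card _ _ _ inner, of 0]
  have "subgroup (inner_autos <#>\<^bsub>AutoGroup G\<^esub> shift_autos M s (centre G)) (AutoGroup G)"
    by (rule S(1)) auto
  moreover have "card inner_autos * p ^ (a - 0) dvd
      card (inner_autos <#>\<^bsub>AutoGroup G\<^esub> shift_autos M s (centre G))"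
    by (rule S(2)) auto
  ultimately show ?thesis using order_dvd_order_AutoGroup a by simp
qed

text \<open>The set consists of the displacements of \<open>c\<close> under inner automorphisms. The
  centralizer of \<open>c\<close> contains \<open>M\<close>, of index p, so \<open>c\<close> has at
  most p conjugates.\<close>

lemma conjugates_of_centralizing_element:
  assumes M: "maximal_subgroup M G" and c: "c \<in> centralizer G M"
  shows "finite {inv c \<otimes> (g \<otimes> c \<otimes> inv g) | g. g \<in> carrier G}"
    and "card {inv c \<otimes> (g \<otimes> c \<otimes> inv g) | g. g \<in> carrier G} \<le> p"
proof -
  have sM: "subgroup M G" using M by (simp add: maximal_subgroup_def)
  obtain s where s: "s \<in> carrier G" "s \<notin> M"
    using M subgroup.subset[OF sM] by (auto simp: maximal_subgroup_def)
  have cc: "c \<in> carrier G" and comm: "\<And>m. m \<in> M \<Longrightarrow> m \<otimes> c = c \<otimes> m"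
    using c by (auto simp: centralizer_def)
  let ?f = "\<lambda>i::nat. inv c \<otimes> (s [^] i \<otimes> c \<otimes> inv (s [^] i))"
  have sub: "{inv c \<otimes> (g \<otimes> c \<otimes> inv g) | g. g \<in> carrier G} \<subseteq> ?f ` {..<p}"
  proof
    fix x assume "x \<in> {inv c \<otimes> (g \<otimes> c \<otimes> inv g) | g. g \<in> carrier G}"
    then obtain g where g: "g \<in> carrier G" "x = inv c \<otimes> (g \<otimes> c \<otimes> inv g)" by auto
    obtain i :: nat and m where im: "m \<in> M" "g = s [^] i \<otimes> m"
      using maximal_subgroup_decomp[OF M s g(1)] by blast
    \<comment> \<open>Only \<open>i mod p\<close> affects the conjugate: the rest of the power of
      \<open>s\<close> lies in \<open>M\<close> and commutes with \<open>c\<close>.\<close>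
    let ?m = "s [^] (p * (i div p)) \<otimes> m"
    have "s [^] (p * (i div p)) \<in> M" using maximal_subgroup_pow_mem_iff[OF M s] by simp
    then have mM: "?m \<in> M" using im(1) sM by (simp add: subgroup.m_closed)
    have mc: "m \<in> carrier G" "?m \<in> carrier G" using im(1) mM maximal_subgroup_closed[OF M] by auto
    have "s [^] i = s [^] (i mod p) \<otimes> s [^] (p * (i div p))" using s by (simp add: nat_pow_mult)
    then have gm: "g = s [^] (i mod p) \<otimes> ?m" using im(2) mc s by (simp add: m_assoc)
    have "g \<otimes> c \<otimes> inv g = s [^] (i mod p) \<otimes> (?m \<otimes> c) \<otimes> inv ?m \<otimes> inv (s [^] (i mod p))"
      unfolding gm using mc(2) s cc by (simp only: inv_mult_group m_assoc nat_pow_closed inv_closed m_closed)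
    also have "\<dots> = s [^] (i mod p) \<otimes> c \<otimes> inv (s [^] (i mod p))"
      unfolding comm[OF mM] using mc(2) s cc by (simp only: m_assoc nat_pow_closed inv_closed m_closed r_inv r_one l_one)
    finally have "x = ?f (i mod p)" using g(2) by simp
    moreover have "i mod p < p" using prime by (simp add: prime_gt_0_nat)
    ultimately show "x \<in> ?f ` {..<p}" by blast
  qed
  show "finite {inv c \<otimes> (g \<otimes> c \<otimes> inv g) | g. g \<in> carrier G}"
    by (rule finite_subset[OF sub]) simp
  have "card {inv c \<otimes> (g \<otimes> c \<otimes> inv g) | g. g \<in> carrier G} \<le> card (?f ` {..<p})"
    by (rule card_mono[OF _ sub]) simp
  also have "\<dots> \<le> p" using card_image_le[of "{..<p}" ?f] by simp
  finally show "card {inv c \<otimes> (g \<otimes> c \<otimes> inv g) | g. g \<in> carrier G} \<le> p" .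
qed

lemma conj_eq_mult_cancel:
  assumes "c \<in> carrier G" "u \<in> carrier G" "g \<otimes> c \<otimes> inv g = c \<otimes> u"
  shows "u = inv c \<otimes> (g \<otimes> c \<otimes> inv g)"
  unfolding assms(3) using assms(1,2) by (simp flip: m_assoc)

text \<open>Both families use all \<open>p ^ r\<close> central shifts, and each loses at most a
  factor p to inner automorphisms. The gain p^(2r - 2) covers p^r exactly when r >= 2.\<close>

lemma order_dvd_if_noncyclic_centre:
  assumes M: "maximal_subgroup M G" "y \<in> carrier G" "y \<notin> M" "centre G \<subseteq> M"
    and N: "maximal_subgroup N G" "c \<in> carrier G" "c \<notin> N" "centre G \<subseteq> N"
    and c: "c \<in> M" "c \<in> centralizer G M" and y: "y \<in> N" "y \<in> centralizer G N"
    and r: "card (centre G) = p ^ r" "2 \<le> r"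
  shows "order G dvd order (AutoGroup G)"
proof (rule two_central_shifts[OF M(1-3) N(1-3) c(1) y(1) centre_subgroup N(4) subset_refl centre_subgroup
      M(4) subset_refl r(1) conjugates_of_centralizing_element(1)[OF M(1) c(2)] _ _ r(1)
      conjugates_of_centralizing_element(1)[OF N(1) y(2)]])
  show "card {inv c \<otimes> (g \<otimes> c \<otimes> inv g) | g. g \<in> carrier G} \<le> p ^ 1"
    using conjugates_of_centralizing_element(2)[OF M(1) c(2)] by simp
  show "card {inv y \<otimes> (g \<otimes> y \<otimes> inv g) | g. g \<in> carrier G} \<le> p ^ 1"
    using conjugates_of_centralizing_element(2)[OF N(1) y(2)] by simp
  show "u \<in> {inv c \<otimes> (g \<otimes> c \<otimes> inv g) | g. g \<in> carrier G}"
    if "g \<in> carrier G" "u \<in> centre G" "g \<otimes> c \<otimes> inv g = c \<otimes> u" for g u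
    using conj_eq_mult_cancel[OF N(2) centre_closed[OF that(2)] that(3)] that(1) by blast
  show "u \<in> {inv y \<otimes> (g \<otimes> y \<otimes> inv g) | g. g \<in> carrier G}"
    if "g \<in> carrier G" "u \<in> centre G" "g \<otimes> y \<otimes> inv g = y \<otimes> u" for g u
    using conj_eq_mult_cancel[OF M(2) centre_closed[OF that(2)] that(3)] that(1) by blast
  show "card (centre G) dvd p ^ (r - 1 + (r - 1))" unfolding r(1) using r(2) by (simp add: le_imp_power_dvd)
qed (use r in auto)

section \<open>Centre of order p: transvections by elements of the second centre\<close>

lemma centre_powers:
  assumes Z: "card (centre G) = p" and w: "w \<in> centre G" "w \<noteq> \<one>"
  shows "z \<in> centre G \<Longrightarrow> \<exists>i::nat. z = w [^] i" and "w [^] (i::nat) = \<one> \<Longrightarrow> p dvd i"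
proof -
  have wc: "w \<in> carrier G" using w(1) by (rule centre_closed)
  have dvd: "p dvd i" if "w [^] i = \<one>" for i :: nat
  proof (rule ccontr)
    assume "\<not> p dvd i"
    then have "coprime (int i) (int p)" using prime
      by (metis coprime_commute coprime_int_iff prime_imp_coprime)
    moreover have "w [^] int i \<in> {\<one>}" using that by (simp add: int_pow_int)
    ultimately show False using mem_subgroup_of_coprime_pow[OF triv_subgroup wc] w(2) by blast
  qed
  then show "w [^] (i::nat) = \<one> \<Longrightarrow> p dvd i" .
  have "inj_on (\<lambda>i::nat. w [^] i) {..<p}"
  proof (rule linorder_inj_onI)
    fix i j :: nat assume ij: "i < j" "i \<in> {..<p}" "j \<in> {..<p}"
    show "w [^] i \<noteq> w [^] j"
    proof
      assume "w [^] i = w [^] j"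
      moreover have "w [^] j = w [^] i \<otimes> w [^] (j - i)" using ij(1) wc by (simp add: nat_pow_mult)
      ultimately have "w [^] (j - i) = \<one>" using wc by simp
      then have "p dvd j - i" by (rule dvd)
      moreover have "0 < j - i" "j - i < p" using ij by auto
      ultimately show False using nat_dvd_not_less by blast
    qed
  qed auto
  then have "card ((\<lambda>i::nat. w [^] i) ` {..<p}) = p" by (simp add: card_image)
  moreover have sub: "(\<lambda>i::nat. w [^] i) ` {..<p} \<subseteq> centre G"
  proof -
    have "w [^] i \<in> centre G" for i :: nat
      using subgroup_int_pow_closed[OF centre_subgroup w(1), of "int i"] by (simp add: int_pow_int)
    then show ?thesis by auto
  qed
  ultimately have "(\<lambda>i::nat. w [^] i) ` {..<p} = centre G"
    using Z card_subset_eq[OF finite_subset_carrier[OF subgroup.subset[OF centre_subgroup]] sub] by simp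
  then show "z \<in> centre G \<Longrightarrow> \<exists>i::nat. z = w [^] i" by auto
qed

lemma centre_pow: "z \<in> centre G \<Longrightarrow> z [^] (i::nat) \<in> centre G"
  using subgroup_int_pow_closed[OF centre_subgroup, of z "int i"] by (simp add: int_pow_int)

text \<open>For \<open>t\<close> in the second centre, taking commutators with \<open>t\<close> is a
  homomorphism from G to the centre with kernel the centralizer of \<open>t\<close>. Its value at
  \<open>s\<close> is \<open>v\<close>, which generates the centre, so the coset of \<open>s\<close>
  generates the quotient.\<close>

lemma centralizer_cyclic_over:
  assumes t: "t \<in> second_centre" and s: "s \<in> carrier G"
    and Z: "\<And>z. z \<in> centre G \<Longrightarrow> \<exists>i::nat. z = v [^] i"
    and v: "v \<in> centre G" "t \<otimes> s = s \<otimes> t \<otimes> v"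
  shows "cyclic_over (centralizer G {t}) s"
proof -
  let ?M = "centralizer G {t}"
  have tc: "t \<in> carrier G" and t2: "\<And>g. g \<in> carrier G \<Longrightarrow> \<exists>z\<in>centre G. t \<otimes> g = g \<otimes> t \<otimes> z"
    using t by (auto simp: second_centre_def)
  have M: "subgroup ?M G" using tc by (intro centralizer_subgroup[OF finite_carrier]) auto
  have "g \<otimes> x \<otimes> inv g \<in> ?M" if g: "g \<in> carrier G" and x: "x \<in> ?M" for g x
  proof -
    have xc: "x \<in> carrier G" and xt: "x \<otimes> t = t \<otimes> x" using x by (auto simp: centralizer_def)
    obtain z where z: "z \<in> centre G" "t \<otimes> inv g = inv g \<otimes> t \<otimes> z" using t2[of "inv g"] g by auto
    have zc: "z \<in> carrier G" using z(1) by (rule centre_closed)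
    have "t \<otimes> g = g \<otimes> (inv g \<otimes> t \<otimes> z) \<otimes> inv z \<otimes> g"
      using g tc zc by (simp add: m_assoc) (simp flip: m_assoc)
    also have "\<dots> = g \<otimes> t \<otimes> inv g \<otimes> inv z \<otimes> g" unfolding z(2)[symmetric] using g tc zc by (simp add: m_assoc)
    also have "\<dots> = g \<otimes> t \<otimes> (inv g \<otimes> (inv z \<otimes> g))" using g tc zc by (simp add: m_assoc)
    also have "inv z \<otimes> g = g \<otimes> inv z"
      using centre_commute[OF subgroup.m_inv_closed[OF centre_subgroup z(1)] g] .
    also have "g \<otimes> t \<otimes> (inv g \<otimes> (g \<otimes> inv z)) = g \<otimes> t \<otimes> inv z" using g tc zc by (simp flip: m_assoc)
    finally have tg: "t \<otimes> g = g \<otimes> t \<otimes> inv z" .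
    \<comment> \<open>Moving \<open>t\<close> past \<open>g\<close> costs \<open>inv z\<close> and
      past \<open>inv g\<close> costs \<open>z\<close>; both are central and cancel.\<close>
    have "t \<otimes> (g \<otimes> x \<otimes> inv g) = g \<otimes> t \<otimes> (inv z \<otimes> x) \<otimes> inv g"
      using tg g tc zc xc by (simp flip: m_assoc)
    also have "inv z \<otimes> x = x \<otimes> inv z"
      using centre_commute[OF subgroup.m_inv_closed[OF centre_subgroup z(1)] xc] .
    also have "g \<otimes> t \<otimes> (x \<otimes> inv z) \<otimes> inv g = g \<otimes> (x \<otimes> t) \<otimes> (inv z \<otimes> inv g)"
      unfolding xt using g tc zc xc by (simp add: m_assoc)
    also have "inv z \<otimes> inv g = inv g \<otimes> inv z"
      using centre_commute[OF subgroup.m_inv_closed[OF centre_subgroup z(1)], of "inv g"] g by simp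
    also have "g \<otimes> (x \<otimes> t) \<otimes> (inv g \<otimes> inv z) = g \<otimes> x \<otimes> (t \<otimes> inv g) \<otimes> inv z"
      using g tc zc xc by (simp add: m_assoc)
    also have "\<dots> = g \<otimes> x \<otimes> inv g \<otimes> t" unfolding z(2) using g tc zc xc by (simp add: m_assoc)
    finally show ?thesis using g xc by (simp add: centralizer_def)
  qed
  then have nM: "?M \<lhd> G" using M by (simp add: normal_inv_iff)
  have "\<exists>i::nat. \<exists>m\<in>?M. g = s [^] i \<otimes> m" if g: "g \<in> carrier G" for g
  proof -
    obtain z where z: "z \<in> centre G" "t \<otimes> g = g \<otimes> t \<otimes> z" using t2 g by blast
    obtain i :: nat where i: "z = v [^] i" using Z[OF z(1)] by blast
    \<comment> \<open>The exponent \<open>i\<close> was chosen so that \<open>s [^] i\<close> and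
      \<open>g\<close> have the same commutator with \<open>t\<close>; hence their quotient
      \<open>?m\<close> commutes with \<open>t\<close>.\<close>
    let ?m = "inv (s [^] i) \<otimes> g"
    have mc: "?m \<in> carrier G" and sm: "g = s [^] i \<otimes> ?m" and zc: "z \<in> carrier G"
      using g s z(1) centre_closed by (auto simp flip: m_assoc)
    have "s [^] i \<otimes> (t \<otimes> ?m) \<otimes> z = s [^] i \<otimes> t \<otimes> (?m \<otimes> z)" using s tc mc zc by (simp only: m_assoc nat_pow_closed m_closed)
    also have "?m \<otimes> z = z \<otimes> ?m" using centre_commute[OF z(1) mc] by simp
    also have "s [^] i \<otimes> t \<otimes> (z \<otimes> ?m) = (s [^] i \<otimes> t \<otimes> z) \<otimes> ?m" using s tc mc zc by (simp only: m_assoc nat_pow_closed m_closed)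
    also have "s [^] i \<otimes> t \<otimes> z = t \<otimes> s [^] i"
      unfolding i by (rule pow_swap_right[OF tc s v, symmetric])
    also have "t \<otimes> s [^] i \<otimes> ?m = t \<otimes> g" using s g tc mc sm by (simp only: m_assoc nat_pow_closed)
    also have "\<dots> = (s [^] i \<otimes> ?m) \<otimes> t \<otimes> z" using z(2) sm by simp
    finally have "s [^] i \<otimes> (t \<otimes> ?m) \<otimes> z = s [^] i \<otimes> (?m \<otimes> t) \<otimes> z"
      using s tc mc zc by (simp only: m_assoc nat_pow_closed m_closed)
    then have "s [^] i \<otimes> (t \<otimes> ?m) = s [^] i \<otimes> (?m \<otimes> t)"
      using s tc mc zc by (simp only: right_cancel m_closed nat_pow_closed)
    then have "t \<otimes> ?m = ?m \<otimes> t"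
      using s tc mc by (simp del: m_assoc)
    then have "?m \<in> ?M" using mc by (simp add: centralizer_def)
    then show ?thesis using sm by blast
  qed
  then show ?thesis using nM s by (simp add: cyclic_over_def)
qed

text \<open>The automorphism fixing the centralizer of \<open>t\<close> and sending \<open>s\<close> to \<open>s \<otimes> t\<close> exists because
  \<open>(s \<otimes> t) [^] p = s [^] p \<otimes> t [^] p \<otimes> v [^] (p choose 2)\<close>; it is not inner because inner
  automorphisms move \<open>s\<close> only by central elements.\<close>
lemma order_dvd_if_transvection:
  assumes t: "t \<in> second_centre" and s: "s \<in> second_centre" and Z: "card (centre G) = p"
    and v: "v \<in> centre G" "v \<noteq> \<one>" "t \<otimes> s = s \<otimes> t \<otimes> v"
    and tp: "t [^] p \<otimes> v [^] (p choose 2) = \<one>"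
  shows "order G dvd order (AutoGroup G)"
proof -
  let ?M = "centralizer G {t}" and ?U = "range (\<lambda>k::nat. t [^] k)"
  have tc: "t \<in> carrier G" and sc: "s \<in> carrier G" and vc: "v \<in> carrier G"
    using t s v(1) centre_closed by (auto simp: second_centre_def)
  have co: "cyclic_over ?M s"
    by (rule centralizer_cyclic_over[OF t sc centre_powers(1)[OF Z v(1,2)] v(1,3)])
  have U: "subgroup ?U G"
    by (rule finite_closed_imp_subgroup[OF finite_carrier]) (use tc in \<open>auto simp: nat_pow_mult\<close>)
  have comm: "t [^] k \<otimes> m = m \<otimes> t [^] k" if "m \<in> ?M" for m and k :: nat
  proof -
    have "m \<in> carrier G" "t \<otimes> m = m \<otimes> t" using that by (auto simp: centralizer_def)
    then show ?thesis using tc group_commutes_pow by auto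
  qed
  have "t \<in> ?M" using tc by (simp add: centralizer_def)
  then have UM: "?U \<subseteq> ?M" using comm tc by (auto simp: centralizer_def)
  have pow: "(s \<otimes> u) [^] i = s [^] i" if u: "u \<in> ?U" and i: "s [^] (i::nat) \<in> ?M" for u i
  proof -
    obtain k :: nat where k: "u = t [^] k" using u by auto
    have "s [^] i \<otimes> t = t \<otimes> s [^] i" using i by (auto simp: centralizer_def)
    also have "\<dots> = s [^] i \<otimes> t \<otimes> v [^] i" by (rule pow_swap_right[OF tc sc v(1,3)])
    finally have "v [^] i = \<one>" using sc tc vc by simp
    then have "p dvd i" by (rule centre_powers(2)[OF Z v(1,2)])
    then obtain j where j: "i = p * j" by (auto elim: dvdE)
    \<comment> \<open>For \<open>u = t [^] k\<close> the commutator with \<open>s\<close> is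
      \<open>v [^] k\<close>, so the correction term in (s u)^p is the k-th power of the left side
      of \<open>tp\<close>, and vanishes.\<close>
    have swap: "t [^] k \<otimes> s = s \<otimes> t [^] k \<otimes> v [^] k" by (rule pow_swap[OF tc sc v(1,3)])
    have "(s \<otimes> t [^] k) [^] p = s [^] p \<otimes> (t [^] k) [^] p \<otimes> (v [^] k) [^] (p choose 2)"
      using mult_pow_swap[OF _ sc centre_pow[OF v(1)] swap] tc by simp
    also have "\<dots> = s [^] p \<otimes> ((t [^] p) [^] k \<otimes> (v [^] (p choose 2)) [^] k)"
      using tc sc vc by (simp add: m_assoc nat_pow_pow mult.commute)
    also have "(t [^] p) [^] k \<otimes> (v [^] (p choose 2)) [^] k = (t [^] p \<otimes> v [^] (p choose 2)) [^] k"
      using pow_mult_distrib[OF centre_commute[OF centre_pow[OF v(1)], of "t [^] p", symmetric]] tc vc by simp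
    finally have "(s \<otimes> t [^] k) [^] p = s [^] p" using tp sc by simp
    then show ?thesis unfolding j k using sc tc by (simp flip: nat_pow_pow)
  qed
  have card_eq: "card (shift_autos ?M s ?U) = card ?U"
    by (rule card_shift_autos[OF finite_carrier co UM]) (use comm pow in auto)
  obtain a where a: "card ?U = p ^ a" using card_subgroup_prime_power[OF U] by blast
  have sub0: "subgroup (?U \<inter> centre G) G" by (rule subgroups_Inter_pair[OF U centre_subgroup])
  obtain b where b: "card (?U \<inter> centre G) = p ^ b" using card_subgroup_prime_power[OF sub0] by blast
  have "t \<notin> centre G"
  proof
    assume "t \<in> centre G"
    then have "s \<otimes> t = s \<otimes> t \<otimes> v" using v(3) centre_commute sc by simp
    then show False using v(2) sc tc vc by simp
  qed
  moreover have "t \<in> ?U" using tc by (auto intro!: image_eqI[of _ _ 1])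
  ultimately have "?U \<inter> centre G \<subset> ?U" by auto
  \<comment> \<open>Inner shifts will turn out to be central. Since \<open>t\<close> is not central,
    at least one factor p of \<open>?U\<close> remains, and |Z| = p asks for no more.\<close>
  then have "p ^ b < p ^ a"
    using psubset_card_mono[OF finite_subset_carrier[OF subgroup.subset[OF U]]] a b by metis
  then have ba: "b < a" using prime by (meson power_strict_increasing_iff prime_gt_1_nat)
  have inner: "u \<in> ?U \<inter> centre G" if g: "g \<in> carrier G" and u: "u \<in> ?U"
    and eq: "g \<otimes> s \<otimes> inv g = s \<otimes> u" for g u
  proof -
    obtain z where z: "z \<in> centre G" "s \<otimes> inv g = inv g \<otimes> s \<otimes> z"
      using s g by (auto simp: second_centre_def)
    have zc: "z \<in> carrier G" using z(1) by (rule centre_closed)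
    have uc: "u \<in> carrier G" using u tc by auto
    have "s \<otimes> u = g \<otimes> (s \<otimes> inv g)" using eq g sc by (simp add: m_assoc)
    also have "\<dots> = s \<otimes> z" unfolding z(2) using g sc zc by (simp flip: m_assoc)
    finally have "u = z" using sc uc zc by simp
    then show ?thesis using u z(1) by simp
  qed
  have card: "card (shift_autos ?M s ?U) = p ^ a" using card_eq a by simp
  note S = inner_shift_product[OF co U UM card _ _ _ inner, of b]
  have fin: "finite (?U \<inter> centre G)" using finite_subset_carrier[OF subgroup.subset[OF sub0]] .
  have "subgroup (inner_autos <#>\<^bsub>AutoGroup G\<^esub> shift_autos ?M s ?U) (AutoGroup G)"
    by (rule S(1)) (use fin b ba in auto)
  moreover have "card inner_autos * p ^ (a - b) dvd card (inner_autos <#>\<^bsub>AutoGroup G\<^esub> shift_autos ?M s ?U)"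
    by (rule S(2)) (use fin b ba in auto)
  moreover have "card (centre G) dvd p ^ (a - b)" unfolding Z using ba by (simp add: dvd_power)
  ultimately show ?thesis by (rule order_dvd_order_AutoGroup)
qed

lemma second_centre_mult:
  assumes "x \<in> second_centre" "y \<in> second_centre"
  shows "x \<otimes> y \<in> second_centre"
proof -
  have c: "x \<in> carrier G" "y \<in> carrier G" using assms by (auto simp: second_centre_def)
  have "\<exists>z\<in>centre G. (x \<otimes> y) \<otimes> g = g \<otimes> (x \<otimes> y) \<otimes> z" if g: "g \<in> carrier G" for g
  proof -
    obtain u where u: "u \<in> centre G" "x \<otimes> g = g \<otimes> x \<otimes> u" using assms(1) g by (auto simp: second_centre_def)
    obtain v where v: "v \<in> centre G" "y \<otimes> g = g \<otimes> y \<otimes> v" using assms(2) g by (auto simp: second_centre_def)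
    have uv: "u \<in> carrier G" "v \<in> carrier G" using u v centre_closed by auto
    have "(x \<otimes> y) \<otimes> g = x \<otimes> (y \<otimes> g)" using c g by (simp add: m_assoc)
    also have "\<dots> = (x \<otimes> g) \<otimes> (y \<otimes> v)" unfolding v(2) using c g uv by (simp add: m_assoc)
    also have "\<dots> = g \<otimes> x \<otimes> (u \<otimes> y) \<otimes> v" unfolding u(2) using c g uv by (simp add: m_assoc)
    also have "u \<otimes> y = y \<otimes> u" using centre_commute[OF u(1) c(2)] .
    finally have "(x \<otimes> y) \<otimes> g = g \<otimes> (x \<otimes> y) \<otimes> (u \<otimes> v)" using c g uv by (simp add: m_assoc)
    then show ?thesis using subgroup.m_closed[OF centre_subgroup u(1) v(1)] by blast
  qed
  then show ?thesis using c by (simp add: second_centre_def)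
qed

lemma second_centre_pow:
  assumes "x \<in> second_centre"
  shows "x [^] (k::nat) \<in> second_centre"
proof (induction k)
  case 0
  show ?case
    using subgroup.one_closed[OF centre_subgroup] by (auto simp: second_centre_def intro!: bexI[of _ \<one>])
next
  case (Suc k)
  then show ?case using second_centre_mult assms by simp
qed

text \<open>The commutator of \<open>x [^] p\<close> with any element is the p-th power of a central
  commutator, hence trivial.\<close>

lemma second_centre_pow_central:
  assumes "x \<in> second_centre"
  shows "x [^] p \<in> centre G"
proof -
  have c: "x \<in> carrier G" using assms by (simp add: second_centre_def)
  have "x [^] p \<otimes> g = g \<otimes> x [^] p" if g: "g \<in> carrier G" for g
  proof -
    obtain z where z: "z \<in> centre G" "x \<otimes> g = g \<otimes> x \<otimes> z" using assms g by (auto simp: second_centre_def)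
    show ?thesis using pow_swap[OF c g z, of p] centre_exponent[OF z(1)] c g by simp
  qed
  then show ?thesis using c by (simp add: centre_def)
qed

text \<open>With \<open>f x = x [^] p \<otimes> w [^] (p choose 2)\<close> one has \<open>f (y \<otimes> c [^] k) = f y \<otimes> f c [^] k\<close>. Since \<open>f c\<close>
  generates the centre unless it is trivial, one of \<open>c\<close> and \<open>y \<otimes> c [^] k\<close> satisfies the power
  condition of a transvection; this treats dihedral, quaternion and odd cases alike.\<close>
lemma order_dvd_if_second_centre_noncommuting:
  assumes c: "c \<in> second_centre" and y: "y \<in> second_centre" and ne: "c \<otimes> y \<noteq> y \<otimes> c"
    and Z: "card (centre G) = p"
  shows "order G dvd order (AutoGroup G)"
proof -
  have cc: "c \<in> carrier G" and yc: "y \<in> carrier G" using c y by (auto simp: second_centre_def)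
  obtain w where w: "w \<in> centre G" "c \<otimes> y = y \<otimes> c \<otimes> w" using c yc by (auto simp: second_centre_def)
  have wc: "w \<in> carrier G" using w(1) by (rule centre_closed)
  have w1: "w \<noteq> \<one>" using ne w(2) cc yc by auto
  let ?b = "p choose 2"
  let ?f = "\<lambda>x. x [^] p \<otimes> w [^] ?b"
  have f: "?f x \<in> centre G" if "x \<in> second_centre" for x
    using second_centre_pow_central[OF that] centre_pow[OF w(1)] subgroup.m_closed[OF centre_subgroup] by blast
  show ?thesis
  proof (cases "?f c = \<one>")
    case True
    show ?thesis by (rule order_dvd_if_transvection[OF c y Z w(1) w1 w(2) True])
  next
    case False
    have "inv (?f y) \<in> centre G" using f[OF y] by (rule subgroup.m_inv_closed[OF centre_subgroup])
    \<comment> \<open>\<open>?f c\<close> is a nontrivial element of a group of order p, so some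
      power of it cancels \<open>?f y\<close>.\<close>
    then obtain k :: nat where k: "inv (?f y) = ?f c [^] k"
      using centre_powers(1)[OF Z f[OF c] False] by blast
    have "?f y \<otimes> inv (?f y) = \<one>" using yc wc by (intro r_inv) auto
    then have fk: "?f y \<otimes> ?f c [^] k = \<one>" unfolding k .
    let ?t = "y \<otimes> c [^] k"
    have t: "?t \<in> second_centre" by (rule second_centre_mult[OF y second_centre_pow[OF c]])
    have iw: "inv w \<in> centre G" using w(1) by (rule subgroup.m_inv_closed[OF centre_subgroup])
    have iwc: "inv w \<in> carrier G" using wc by simp
    have "y \<otimes> c = c \<otimes> y \<otimes> inv w" unfolding w(2) using cc yc wc by (simp add: m_assoc)
    then have "?t \<otimes> c = (c \<otimes> y \<otimes> inv w) \<otimes> c [^] k"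
      using cc yc nat_pow_Suc2[OF cc, of k] by (simp add: m_assoc) (simp flip: m_assoc)
    also have "\<dots> = c \<otimes> y \<otimes> (inv w \<otimes> c [^] k)" using cc yc iwc by (simp add: m_assoc)
    also have "inv w \<otimes> c [^] k = c [^] k \<otimes> inv w" using centre_commute[OF iw] cc by simp
    finally have tcw: "?t \<otimes> c = c \<otimes> ?t \<otimes> inv w" using cc yc iwc by (simp add: m_assoc)
    \<comment> \<open>Now \<open>?t\<close> is the transvecting element and \<open>c\<close> the
      moved one, so the commutator is \<open>inv w\<close>. Twice \<open>p choose 2\<close> is a
      multiple of p, so \<open>w [^] ?b\<close> is its own inverse and the power condition is the
      same for \<open>w\<close> and \<open>inv w\<close>.\<close>
    have w2b: "w [^] ?b \<otimes> w [^] ?b = \<one>"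
    proof -
      have "even (p * (p - 1))" by (cases p) auto
      then have "2 * ?b = p * (p - 1)" unfolding choose_two by (rule dvd_mult_div_cancel)
      then have "w [^] ?b \<otimes> w [^] ?b = (w [^] p) [^] (p - 1)"
        using wc by (simp add: nat_pow_mult nat_pow_pow flip: mult_2)
      then show ?thesis using centre_exponent[OF w(1)] by simp
    qed
    have iwb: "inv w [^] ?b = w [^] ?b"
      using w2b wc nat_pow_inv[OF wc, of ?b] inv_equality[of "w [^] ?b" "w [^] ?b"] by simp
    have swap: "c [^] k \<otimes> y = y \<otimes> c [^] k \<otimes> w [^] k" by (rule pow_swap[OF cc yc w])
    have "?t [^] p = y [^] p \<otimes> (c [^] k) [^] p \<otimes> (w [^] k) [^] ?b"
      using mult_pow_swap[OF _ yc centre_pow[OF w(1)] swap] cc by simp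
    also have "\<dots> = y [^] p \<otimes> ((c [^] p) [^] k \<otimes> (w [^] ?b) [^] k)"
      using cc yc wc by (simp add: m_assoc nat_pow_pow mult.commute)
    also have "(c [^] p) [^] k \<otimes> (w [^] ?b) [^] k = ?f c [^] k"
      using pow_mult_distrib[OF centre_commute[OF centre_pow[OF w(1)], of "c [^] p", symmetric]] cc wc by simp
    finally have "?t [^] p \<otimes> w [^] ?b = y [^] p \<otimes> (?f c [^] k \<otimes> w [^] ?b)" using cc yc wc by (simp add: m_assoc)
    also have "?f c [^] k \<otimes> w [^] ?b = w [^] ?b \<otimes> ?f c [^] k"
      using centre_commute[OF centre_pow[OF w(1)], of "?f c [^] k"] cc wc by simp
    also have "y [^] p \<otimes> (w [^] ?b \<otimes> ?f c [^] k) = \<one>" using fk cc yc wc by (simp add: m_assoc)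
    finally have tp: "?t [^] p \<otimes> inv w [^] ?b = \<one>" unfolding iwb .
    have "inv w \<noteq> \<one>" using w1 wc by simp
    then show ?thesis by (rule order_dvd_if_transvection[OF t c Z iw _ tcw tp])
  qed
qed

section \<open>Centre outside some maximal subgroup, and the abelian case\<close>

lemma maximal_subgroup_exchange:
  assumes M: "maximal_subgroup M G" and N: "maximal_subgroup N G" and z: "z \<in> N" "z \<notin> M"
  shows "\<exists>y\<in>M. y \<notin> N"
proof (rule ccontr)
  assume "\<not> ?thesis"
  then have "M \<subseteq> N" by auto
  then have "N = M" using M N unfolding maximal_subgroup_def by blast
  then show False using z by simp
qed

text \<open>Shifting \<open>y\<close> by the whole centre loses at most |M \<inter> Z|, since
  \<open>M\<close> is normal and conjugation displaces \<open>y\<close> within \<open>M\<close>.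
  Shifting \<open>z\<close> by M \<inter> Z loses nothing, since \<open>z\<close> is central. The
  losses of the first family are the gains of the second, and the total is |Z|.\<close>

lemma order_dvd_if_central_factor_nonabelian:
  assumes M: "maximal_subgroup M G" and z: "z \<in> centre G" "z \<notin> M" and na: "centre G \<noteq> carrier G"
  shows "order G dvd order (AutoGroup G)"
proof -
  interpret M: normal M G by (rule maximal_subgroup_normal[OF M])
  obtain N where N: "maximal_subgroup N G" "centre G \<subseteq> N"
    using exists_maximal_subgroup[OF centre_subgroup na] by blast
  obtain y where y: "y \<in> M" "y \<notin> N" using maximal_subgroup_exchange[OF M N(1) _ z(2)] z(1) N(2) by auto
  have V: "subgroup (M \<inter> centre G) G" by (rule subgroups_Inter_pair[OF M.is_subgroup centre_subgroup])
  obtain r where r: "card (centre G) = p ^ r" using card_subgroup_prime_power[OF centre_subgroup] by blast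
  obtain b where b: "card (M \<inter> centre G) = p ^ b" using card_subgroup_prime_power[OF V] by blast
  have "p ^ b \<le> p ^ r" unfolding b[symmetric] r[symmetric]
    by (rule card_mono[OF finite_subset_carrier[OF subgroup.subset[OF centre_subgroup]]]) auto
  then have br: "b \<le> r" using prime by (meson power_le_imp_le_exp prime_gt_1_nat)
  show ?thesis
  proof (rule two_central_shifts[OF M centre_closed[OF z(1)] z(2) N(1) M.mem_carrier[OF y(1)] y(2) y(1)
        _ centre_subgroup N(2) subset_refl V _ _ r finite_subset_carrier[OF subgroup.subset[OF V]] _ br
        b, of "{\<one>}" 0])
    show "z \<in> N" using z(1) N(2) by auto
    show "u \<in> M \<inter> centre G" if g: "g \<in> carrier G" and u: "u \<in> centre G"
      and eq: "g \<otimes> y \<otimes> inv g = y \<otimes> u" for g u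
    proof -
      have "y \<otimes> u \<in> M" using M.inv_op_closed2[OF g y(1)] eq by simp
      then have "inv y \<otimes> (y \<otimes> u) \<in> M" using y(1) by (simp add: M.m_closed M.m_inv_closed)
      moreover have "inv y \<otimes> (y \<otimes> u) = u"
        using M.mem_carrier[OF y(1)] centre_closed[OF u] by (simp flip: m_assoc)
      ultimately show ?thesis using u by simp
    qed
    show "v \<in> {\<one>}" if g: "g \<in> carrier G" and v: "v \<in> M \<inter> centre G"
      and eq: "g \<otimes> z \<otimes> inv g = z \<otimes> v" for g v
      using eq centre_conj(2)[OF z(1) g] centre_closed[OF z(1)] v centre_closed[of v] by simp
    show "card (centre G) dvd p ^ (r - b + (b - 0))" using r br by simp
  qed (use b in auto)
qed

text \<open>Conjugations are trivial, so nothing is lost. The families shift \<open>z\<close> by all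
  of \<open>M\<close> and \<open>y\<close> by \<open>N \<inter> M\<close>, the latter smaller so
  that one family normalizes the other; the orders are p^(n-1) and p^b with b >= n - 2.\<close>

lemma order_dvd_if_abelian:
  assumes ab: "centre G = carrier G" and n: "3 \<le> n"
  shows "order G dvd order (AutoGroup G)"
proof -
  have conj: "u = \<one>" if "g \<in> carrier G" "x \<in> carrier G" "u \<in> carrier G" "g \<otimes> x \<otimes> inv g = x \<otimes> u" for g x u
    using that centre_conj(2)[of x g] ab by simp
  have exists_max: "\<exists>M. maximal_subgroup M G \<and> x \<in> M" if x: "x \<in> carrier G" for x
  proof -
    let ?H = "range (\<lambda>k::nat. x [^] k)"
    have H: "subgroup ?H G"
      by (rule finite_closed_imp_subgroup[OF finite_carrier]) (use x in \<open>auto simp: nat_pow_mult\<close>)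
    \<comment> \<open>In exponent p a cyclic subgroup has at most p elements, so it is proper and
      extends to a maximal subgroup.\<close>
    have "?H \<subseteq> (\<lambda>k::nat. x [^] k) ` {..<p}"
    proof
      fix h assume "h \<in> ?H"
      then obtain k :: nat where h: "h = x [^] k" by auto
      have "x [^] k = x [^] (k mod p) \<otimes> (x [^] p) [^] (k div p)" using x by (simp add: nat_pow_mult nat_pow_pow)
      then have "h = x [^] (k mod p)" using h x centre_exponent ab by simp
      moreover have "k mod p < p" using prime by (simp add: prime_gt_0_nat)
      ultimately show "h \<in> (\<lambda>k::nat. x [^] k) ` {..<p}" by blast
    qed
    then have "card ?H \<le> card ((\<lambda>k::nat. x [^] k) ` {..<p})" by (rule card_mono[rotated]) simp
    also have "\<dots> \<le> p" using card_image_le[of "{..<p}" "\<lambda>k::nat. x [^] k"] by simp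
    also have "p < p ^ n" using prime_gt_1_nat[OF prime] n power_strict_increasing[of 1 n p] by simp
    finally have "?H \<noteq> carrier G" using order_eq by (auto simp: order_def)
    then obtain M where M: "maximal_subgroup M G" "?H \<subseteq> M" using exists_maximal_subgroup[OF H] by blast
    have "x [^] (1::nat) \<in> ?H" by (rule rangeI)
    then show ?thesis using M x by auto
  qed
  obtain M where M: "maximal_subgroup M G" using exists_max[OF one_closed] by blast
  have sM: "subgroup M G" using M by (simp add: maximal_subgroup_def)
  obtain z where z: "z \<in> carrier G" "z \<notin> M"
    using M subgroup.subset[OF sM] by (auto simp: maximal_subgroup_def)
  obtain N where N: "maximal_subgroup N G" "z \<in> N" using exists_max[OF z(1)] by blast
  have sN: "subgroup N G" using N by (simp add: maximal_subgroup_def)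
  obtain y where y: "y \<in> M" "y \<notin> N" using maximal_subgroup_exchange[OF M N(1,2) z(2)] by blast
  have yc: "y \<in> carrier G" using maximal_subgroup_closed[OF M y(1)] .
  have p0: "p > 1" using prime by (rule prime_gt_1_nat)
  have cards: "card K = p ^ (n - 1)" if "maximal_subgroup K G" for K
  proof -
    have "card K * p = p ^ (n - 1) * p" using card_maximal_subgroup[OF that] n by (simp flip: power_Suc2)
    then show ?thesis using p0 by simp
  qed
  have V: "subgroup (N \<inter> M) G" by (rule subgroups_Inter_pair[OF sN sM])
  obtain b where b: "card (N \<inter> M) = p ^ b" using card_subgroup_prime_power[OF V] by blast
  have NM: "subgroup (N <#> M) G"
    by (rule subgroup_product[OF sN sM]) (use normal.inv_op_closed2[OF maximal_subgroup_normal[OF N(1)]]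
        subgroup.mem_carrier[OF sM] in auto)
  \<comment> \<open>The product formula bounds \<open>N \<inter> M\<close> from below, because
    \<open>N <#> M\<close> has at most \<open>p ^ n\<close> elements.\<close>
  have "p ^ (n - 1) * p ^ (n - 1) = card (N <#> M) * p ^ b"
    using card_subgroup_product[OF finite_carrier sN sM NM] cards[OF M] cards[OF N(1)] b by simp
  also have "\<dots> \<le> p ^ n * p ^ b"
    using card_mono[OF finite_carrier subgroup.subset[OF NM]] order_eq by (simp add: order_def)
  finally have "p ^ ((n - 1) + (n - 1)) \<le> p ^ (n + b)" by (simp only: power_add)
  then have "(n - 1) + (n - 1) \<le> n + b" using p0 by (meson power_le_imp_le_exp)
  then have nb: "n \<le> (n - 1) + b" using n by linarith
  show ?thesis
  proof (rule two_central_shifts[OF N(1) yc y(2) M z N(2) y(1) sM subset_refl _ V _ _ cards[OF M] _ _ _ b,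
        of "{\<one>}" 0 "{\<one>}" 0])
    show "M \<subseteq> centre G" using ab subgroup.subset[OF sM] by simp
    show "card (centre G) dvd p ^ (n - 1 - 0 + (b - 0))"
      using ab order_eq nb by (simp add: order_def le_imp_power_dvd)
    show "u \<in> {\<one>}" if "g \<in> carrier G" "u \<in> M" "g \<otimes> z \<otimes> inv g = z \<otimes> u" for g u
      using conj[OF that(1) z(1) _ that(3)] maximal_subgroup_closed[OF M that(2)] by simp
    show "u \<in> {\<one>}" if "g \<in> carrier G" "u \<in> N \<inter> M" "g \<otimes> y \<otimes> inv g = y \<otimes> u" for g u
      using conj[OF that(1) yc _ that(3)] maximal_subgroup_closed[OF M, of u] that(2) by simp
  qed auto
qed

section \<open>Maximal subgroups with noncentral centralizing elements\<close>

lemma mem_centre_if_centralizes_maximal: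
  assumes K: "maximal_subgroup K G" and x: "x \<in> centralizer G K"
    and s: "s \<in> carrier G" "s \<notin> K" and xs: "x \<otimes> s = s \<otimes> x"
  shows "x \<in> centre G"
proof -
  have xc: "x \<in> carrier G" and xK: "\<And>m. m \<in> K \<Longrightarrow> x \<otimes> m = m \<otimes> x" using x by (auto simp: centralizer_def)
  have "x \<otimes> g = g \<otimes> x" if g: "g \<in> carrier G" for g
  proof -
    obtain i :: nat and m where im: "m \<in> K" "g = s [^] i \<otimes> m"
      using maximal_subgroup_decomp[OF K s g] by blast
    have mc: "m \<in> carrier G" using maximal_subgroup_closed[OF K im(1)] .
    have si: "s [^] i \<otimes> x = x \<otimes> s [^] i" using group_commutes_pow[OF xs[symmetric] s(1) xc] .
    have "x \<otimes> g = (x \<otimes> s [^] i) \<otimes> m" using im(2) xc s mc by (simp add: m_assoc)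
    also have "\<dots> = s [^] i \<otimes> (x \<otimes> m)" unfolding si[symmetric] using xc s mc by (simp add: m_assoc)
    also have "\<dots> = g \<otimes> x" unfolding xK[OF im(1)] using im(2) xc s mc by (simp add: m_assoc)
    finally show ?thesis .
  qed
  then show ?thesis using xc by (simp add: centre_def)
qed

text \<open>The commutator of \<open>c\<close> and \<open>y\<close> centralizes both
  \<open>M\<close> and \<open>N\<close>, as centralizers of normal subgroups are normal. It commutes
  with \<open>M\<close> and with \<open>y\<close>, which generate G, so it is central; the order of
  the centre then selects the method.\<close>

lemma order_dvd_if_centralizing_pair:
  assumes M: "maximal_subgroup M G" "centre G \<subseteq> M" and N: "maximal_subgroup N G" "centre G \<subseteq> N"
    and c: "c \<in> centralizer G M" "c \<notin> centre G" "c \<notin> N"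
    and y: "y \<in> centralizer G N" "y \<notin> centre G"
  shows "order G dvd order (AutoGroup G)"
proof -
  have cc: "c \<in> carrier G" and yc: "y \<in> carrier G" using c(1) y(1) by (auto simp: centralizer_def)
  have cM: "\<And>m. m \<in> M \<Longrightarrow> c \<otimes> m = m \<otimes> c" and yN: "\<And>m. m \<in> N \<Longrightarrow> y \<otimes> m = m \<otimes> y"
    using c(1) y(1) by (auto simp: centralizer_def)
  have Mn: "M \<lhd> G" and Nn: "N \<lhd> G" using M N maximal_subgroup_normal by auto
  \<comment> \<open>Were \<open>c\<close> outside \<open>M\<close>, it would generate G together
    with \<open>M\<close>, and commuting with both it would be central.\<close>
  have c_in: "c \<in> M" using mem_centre_if_centralizes_maximal[OF M(1) c(1) cc] c(2) by blast
  have y_in: "y \<in> N" using mem_centre_if_centralizes_maximal[OF N(1) y(1) yc] y(2) by blast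
  have ne: "c \<otimes> y \<noteq> y \<otimes> c" using mem_centre_if_centralizes_maximal[OF N(1) y(1) cc c(3)] y(2) by metis
  have y_out: "y \<notin> M" using cM ne by blast
  let ?w = "inv c \<otimes> (inv y \<otimes> c \<otimes> y)"
  have wc: "?w \<in> carrier G" using cc yc by simp
  have wM: "?w \<in> centralizer G M"
    using subgroup.m_closed[OF centralizer_subgroup[OF finite_carrier]]
      subgroup.m_inv_closed[OF centralizer_subgroup[OF finite_carrier]] centralizer_conj[OF Mn c(1) yc] c(1)
      normal_imp_subgroup[OF Mn] subgroup.subset by blast
  \<comment> \<open>Regrouping the same commutator as a conjugate of \<open>inv y\<close> times
    \<open>y\<close> shows that it centralizes \<open>N\<close>.\<close>
  have "inv c \<otimes> inv y \<otimes> c \<in> centralizer G N"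
    using centralizer_conj[OF Nn _ cc]
      subgroup.m_inv_closed[OF centralizer_subgroup[OF finite_carrier subgroup.subset[OF normal_imp_subgroup[OF Nn]]] y(1)] .
  then have "(inv c \<otimes> inv y \<otimes> c) \<otimes> y \<in> centralizer G N"
    using subgroup.m_closed[OF centralizer_subgroup[OF finite_carrier subgroup.subset[OF normal_imp_subgroup[OF Nn]]] _ y(1)] by blast
  then have "?w \<in> centralizer G N" using cc yc by (simp add: m_assoc)
  then have "?w \<otimes> y = y \<otimes> ?w" using y_in by (simp add: centralizer_def)
  then have w: "?w \<in> centre G" by (rule mem_centre_if_centralizes_maximal[OF M(1) wM yc y_out])
  have swap: "c \<otimes> y = y \<otimes> c \<otimes> ?w" using cc yc by (simp add: m_assoc) (simp flip: m_assoc)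
  have w1: "?w \<noteq> \<one>"
  proof
    assume "?w = \<one>"
    then have "c \<otimes> y = y \<otimes> c" using swap cc yc by simp
    then show False using ne by simp
  qed
  obtain r where r: "card (centre G) = p ^ r" using card_subgroup_prime_power[OF centre_subgroup] by blast
  have r0: "r \<noteq> 0"
  proof
    assume "r = 0"
    then have "card (centre G) = 1" using r by simp
    then show False using w w1 subgroup.one_closed[OF centre_subgroup] by (auto simp: card_1_singleton_iff)
  qed
  show ?thesis
  proof (cases "r = 1")
    case False
    then have "2 \<le> r" using r0 by simp
    then show ?thesis
      by (rule order_dvd_if_noncyclic_centre[OF M(1) yc y_out M(2) N(1) cc c(3) N(2) c_in c(1) y_in y(1) r])
  next
    case True
    \<comment> \<open>In a decomposition of \<open>g\<close> over \<open>M\<close> and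
      \<open>y\<close>, the part in \<open>M\<close> commutes with \<open>c\<close> and the power of
      \<open>y\<close> contributes only a power of the central commutator.\<close>
    have c2: "c \<in> second_centre"
    proof -
      have "\<exists>z\<in>centre G. c \<otimes> g = g \<otimes> c \<otimes> z" if g: "g \<in> carrier G" for g
      proof -
        obtain i :: nat and m where im: "m \<in> M" "g = y [^] i \<otimes> m"
          using maximal_subgroup_decomp[OF M(1) yc y_out g] by blast
        have mc: "m \<in> carrier G" using maximal_subgroup_closed[OF M(1) im(1)] .
        have wi: "?w [^] i \<in> centre G" by (rule centre_pow[OF w])
        have wic: "?w [^] i \<in> carrier G" using wi by (rule centre_closed)
        have "c \<otimes> g = (c \<otimes> y [^] i) \<otimes> m" using im(2) cc yc mc by (simp add: m_assoc)
        also have "c \<otimes> y [^] i = y [^] i \<otimes> c \<otimes> ?w [^] i" by (rule pow_swap_right[OF cc yc w swap])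
        also have "y [^] i \<otimes> c \<otimes> ?w [^] i \<otimes> m = y [^] i \<otimes> c \<otimes> (?w [^] i \<otimes> m)"
          using cc yc mc wic by (simp only: m_assoc m_closed nat_pow_closed)
        also have "?w [^] i \<otimes> m = m \<otimes> ?w [^] i" using centre_commute[OF wi mc] .
        also have "y [^] i \<otimes> c \<otimes> (m \<otimes> ?w [^] i) = y [^] i \<otimes> (c \<otimes> m) \<otimes> ?w [^] i"
          using cc yc mc wic by (simp only: m_assoc m_closed nat_pow_closed)
        also have "\<dots> = g \<otimes> c \<otimes> ?w [^] i" unfolding cM[OF im(1)] im(2)
          using cc yc mc wic by (simp only: m_assoc m_closed nat_pow_closed)
        finally show ?thesis using wi by blast
      qed
      then show ?thesis using cc by (simp add: second_centre_def)
    qed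
    have y2: "y \<in> second_centre"
    proof -
      have iw: "inv ?w \<in> centre G" using w by (rule subgroup.m_inv_closed[OF centre_subgroup])
      have iwc: "inv ?w \<in> carrier G" using wc by (rule inv_closed)
      have swap': "y \<otimes> c = c \<otimes> y \<otimes> inv ?w"
        using swap cc yc wc by (metis inv_solve_right m_closed)
      have "\<exists>z\<in>centre G. y \<otimes> g = g \<otimes> y \<otimes> z" if g: "g \<in> carrier G" for g
      proof -
        obtain i :: nat and m where im: "m \<in> N" "g = c [^] i \<otimes> m"
          using maximal_subgroup_decomp[OF N(1) cc c(3) g] by blast
        have mc: "m \<in> carrier G" using maximal_subgroup_closed[OF N(1) im(1)] .
        have wi: "inv ?w [^] i \<in> centre G" by (rule centre_pow[OF iw])
        have wic: "inv ?w [^] i \<in> carrier G" using wi by (rule centre_closed)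
        have "y \<otimes> g = (y \<otimes> c [^] i) \<otimes> m" using im(2) cc yc mc by (simp add: m_assoc)
        also have "y \<otimes> c [^] i = c [^] i \<otimes> y \<otimes> inv ?w [^] i" by (rule pow_swap_right[OF yc cc iw swap'])
        also have "c [^] i \<otimes> y \<otimes> inv ?w [^] i \<otimes> m = c [^] i \<otimes> y \<otimes> (inv ?w [^] i \<otimes> m)"
          using cc yc mc wic by (simp only: m_assoc m_closed nat_pow_closed)
        also have "inv ?w [^] i \<otimes> m = m \<otimes> inv ?w [^] i" using centre_commute[OF wi mc] .
        also have "c [^] i \<otimes> y \<otimes> (m \<otimes> inv ?w [^] i) = c [^] i \<otimes> (y \<otimes> m) \<otimes> inv ?w [^] i"
          using cc yc mc wic by (simp only: m_assoc m_closed nat_pow_closed)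
        also have "\<dots> = g \<otimes> y \<otimes> inv ?w [^] i" unfolding yN[OF im(1)] im(2)
          using cc yc mc wic by (simp only: m_assoc m_closed nat_pow_closed)
        finally show ?thesis using wi by blast
      qed
      then show ?thesis using yc by (simp add: second_centre_def)
    qed
    have "card (centre G) = p" using r True by simp
    then show ?thesis by (rule order_dvd_if_second_centre_noncommuting[OF c2 y2 ne])
  qed
qed

end

theorem mainTheorem2:
  fixes G :: "('a, 'b) monoid_scheme" and p :: nat
  assumes "Factorial_Ring.prime p"
    and "finite_p_group p G"
    and "\<not> cyclic_group G"
    and "order G \<ge> p ^ 3"
    and "elementary_abelian p (G\<lparr>carrier := centre G\<rparr>)"
    and "centralizer G (centre (G\<lparr>carrier := frattini G\<rparr>)) \<noteq> frattini G"
  shows "order G dvd order (AutoGroup G)"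
proof -
  obtain n where G: "group G" "finite (carrier G)" "order G = p ^ n"
    using assms(2) by (auto simp: finite_p_group_def)
  interpret group G by (rule G(1))
  \<comment> \<open>Element orders in the centre as a group of its own become a power identity in G;
    the identity element, exempt from having order p, is treated apart.\<close>
  have exponent: "z [^]\<^bsub>G\<^esub> p = \<one>\<^bsub>G\<^esub>" if z: "z \<in> centre G" for z
  proof (cases "z = \<one>\<^bsub>G\<^esub>")
    case False
    let ?Z = "G\<lparr>carrier := centre G\<rparr>"
    have "group ?Z" by (rule subgroup_imp_group[OF centre_subgroup])
    moreover have "group.ord ?Z z = p" using assms(5) z False by (simp add: elementary_abelian_def)
    ultimately have "z [^]\<^bsub>?Z\<^esub> p = \<one>\<^bsub>?Z\<^esub>" using group.pow_ord_eq_1[of ?Z z] z by simp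
    then show ?thesis by (simp flip: nat_pow_consistent)
  qed simp
  interpret elementary_centre_group G p n
    by unfold_locales (use assms(1) G exponent in auto)
  have "3 \<le> n" using assms(4) G(3) prime by (metis power_le_imp_le_exp prime_gt_1_nat)
  show ?thesis
  proof (cases "centre G \<subseteq> frattini G")
    case False
    then obtain z M where z: "z \<in> centre G" "maximal_subgroup M G" "z \<notin> M"
      using centre_closed by (auto simp: frattini_def)
    show ?thesis
    proof (cases "centre G = carrier G")
      case True
      then show ?thesis using \<open>3 \<le> n\<close> by (rule order_dvd_if_abelian)
    next
      case False
      then show ?thesis by (rule order_dvd_if_central_factor_nonabelian[OF z(2,1,3)])
    qed
  next
    case True
    have ZM: "centre G \<subseteq> M" if "maximal_subgroup M G" for M
      using True that by (auto simp: frattini_def)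
    \<comment> \<open>This inclusion always holds, so the assumed inequality yields an element of
      the centralizer outside the Frattini subgroup.\<close>
    have "frattini G \<subseteq> centralizer G (centre (G\<lparr>carrier := frattini G\<rparr>))"
      by (auto simp: frattini_def centralizer_def centre_def)
    then obtain k where k: "k \<in> centralizer G (centre (G\<lparr>carrier := frattini G\<rparr>))" "k \<notin> frattini G"
      using assms(6) by blast
    have kc: "k \<in> carrier G" using k(1) by (simp add: centralizer_def)
    then obtain M where M: "maximal_subgroup M G" "k \<notin> M" using k(2) by (auto simp: frattini_def)
    show ?thesis
    proof (cases "centralizer G M \<subseteq> centre G")
      case True
      then show ?thesis by (rule order_dvd_if_centralizer_maximal[OF M(1) kc M(2) ZM[OF M(1)]])
    next
      case False
      then obtain c where c: "c \<in> centralizer G M" "c \<notin> centre G" by blast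
      have cc: "c \<in> carrier G" using c(1) by (simp add: centralizer_def)
      have "c \<notin> frattini G"
      proof
        \<comment> \<open>The Frattini subgroup lies in \<open>M\<close>, which \<open>c\<close>
          centralizes; so \<open>c\<close> would be in its centre and commute with \<open>k\<close>.
          But \<open>M\<close> and \<open>k\<close> generate G, which would make \<open>c\<close>
          central.\<close>
        assume cF: "c \<in> frattini G"
        then have "c \<in> centre (G\<lparr>carrier := frattini G\<rparr>)"
          using c(1) M(1) by (auto simp: centre_def centralizer_def frattini_def)
        then have ck: "c \<otimes>\<^bsub>G\<^esub> k = k \<otimes>\<^bsub>G\<^esub> c" using k(1) by (simp add: centralizer_def)
        show False using mem_centre_if_centralizes_maximal[OF M(1) c(1) kc M(2) ck] c(2) by simp
      qed
      then obtain N where N: "maximal_subgroup N G" "c \<notin> N" using cc by (auto simp: frattini_def)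
      show ?thesis
      proof (cases "centralizer G N \<subseteq> centre G")
        case True
        then show ?thesis by (rule order_dvd_if_centralizer_maximal[OF N(1) cc N(2) ZM[OF N(1)]])
      next
        case False
        then obtain y where "y \<in> centralizer G N" "y \<notin> centre G" by blast
        then show ?thesis
          by (rule order_dvd_if_centralizing_pair[OF M(1) ZM[OF M(1)] N(1) ZM[OF N(1)] c N(2)])
      qed
    qed
  qed
qed

end
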